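(* Let $q\in\mathbb{C}\setminus\{0\}$ be not a root of unity and let $b_0\in\mathbb{C}\setminus\{0\}$. Consider the $U_q(\mathfrak{sl}_2)$-module algebra structure on the quantum plane $\mathbb{C}_q[x,y]$ given by $$\mathsf{k}(x)=qx,\quad \mathsf{k}(y)=q^{-2}y,\quad \mathsf{e}(x)=0,\quad \mathsf{e}(y)=b_0,\quad \mathsf{f}(x)=b_0^{-1}xy,\quad \mathsf{f}(y)=-qb_0^{-1}y^2,$$ viewed as a representation of $U_q(\mathfrak{sl}_2)$ in the vector space $\mathbb{C}_q[x,y]$. Then it splits into the direct sum of subrepresentations $\mathbb{C}_q[x,y]=\bigoplus_{n=0}^\infty\mathcal{V}_n$, where $\mathcal{V}_n=x^n\mathbb{C}[y]$. Each $\mathcal{V}_n$ admits a composition series of the form $0\subset\mathcal{J}_n\subset\mathcal{V}_n$, where the simple submodule $\mathcal{J}_n$, of dimension $n+1$, is the linear span of $x^n,x^ny,\ldots,x^ny^{n-1},x^ny^n$; its isomorphism class is $\mathcal{V}_{1,n}$, and $\mathcal{J}_n$ is not a direct summand in the category of $U_q(\mathfrak{sl}_2)$-modules (there exists no submodule $\mathcal{W}$ such that $\mathcal{V}_n=\mathcal{J}_n\oplus\mathcal{W}$). The quotient module $\mathcal{Z}_n=\mathcal{V}_n/\mathcal{J}_n$ is isomorphic to the (simple) Verma module $\mathcal{V}(q^{-n-2})$.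
   Context: The quantum plane $\mathbb{C}_q[x,y]$ is the unital associative $\mathbb{C}$-algebra with generators $x,y$ and the single relation $yx=qxy$; the monomials $x^my^n$ ($m,n\ge 0$) form a basis. $\mathbb{C}[y]$ denotes the linear span of $\{y^p\mid p\ge 0\}$. $U_q(\mathfrak{sl}_2)$ is the unital associative $\mathbb{C}$-algebra with generators $\mathsf{k},\mathsf{k}^{-1},\mathsf{e},\mathsf{f}$ and relations $\mathsf{k}^{-1}\mathsf{k}=\mathsf{k}\mathsf{k}^{-1}=\mathbf{1}$, $\mathsf{k}\mathsf{e}=q^2\mathsf{e}\mathsf{k}$, $\mathsf{k}\mathsf{f}=q^{-2}\mathsf{f}\mathsf{k}$, $\mathsf{e}\mathsf{f}-\mathsf{f}\mathsf{e}=\frac{\mathsf{k}-\mathsf{k}^{-1}}{q-q^{-1}}$, with comultiplication $\Delta(\mathsf{k})=\mathsf{k}\otimes\mathsf{k}$, $\Delta(\mathsf{e})=\mathbf{1}\otimes\mathsf{e}+\mathsf{e}\otimes\mathsf{k}$, $\Delta(\mathsf{f})=\mathsf{f}\otimes\mathbf{1}+\mathsf{k}^{-1}\otimes\mathsf{f}$ and counit $\varepsilon(\mathsf{k})=1$, $\varepsilon(\mathsf{e})=\varepsilon(\mathsf{f})=0$. A $U_q(\mathfrak{sl}_2)$-module algebra structure on $A=\mathbb{C}_q[x,y]$ is an algebra homomorphism $\pi:U_q(\mathfrak{sl}_2)\to\operatorname{End}_{\mathbb{C}}A$ such that $\pi(h)(ab)=\sum_i\pi(h_i')(a)\,\pi(h_i'')(b)$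 (where $\Delta(h)=\sum_i h_i'\otimes h_i''$) and $\pi(h)(\mathbf{1})=\varepsilon(h)\mathbf{1}$ for all $h$ and all $a,b\in A$; one writes $h(a)$ for $\pi(h)(a)$. It is uniquely determined by the values of $\mathsf{k},\mathsf{e},\mathsf{f}$ on $x,y$; the values above do define such a structure. $\mathcal{V}_{1,n}$ denotes the simple $(n+1)$-dimensional $U_q(\mathfrak{sl}_2)$-module with highest weight $q^n$: it has basis $v_0,\dots,v_n$ with $\mathsf{k}v_i=q^{n-2i}v_i$, $\mathsf{e}v_0=0$, $\mathsf{e}v_i=\frac{q^{n-i+1}-q^{-(n-i+1)}}{q-q^{-1}}v_{i-1}$ for $i\ge1$, $\mathsf{f}v_i=\frac{q^{i+1}-q^{-i-1}}{q-q^{-1}}v_{i+1}$ for $i<n$, $\mathsf{f}v_n=0$. For $\lambda\in\mathbb{C}\setminus\{0\}$ the Verma module $\mathcal{V}(\lambda)$ has basis $\{v_i\mid i\ge 0\}$ with $\mathsf{k}v_i=\lambda q^{-2i}v_i$, $\mathsf{k}^{-1}v_i=\lambda^{-1}q^{2i}v_i$, $\mathsf{e}v_0=0$, $\mathsf{e}v_{i+1}=\frac{\lambda q^{-i}-\lambda^{-1}q^i}{q-q^{-1}}v_i$, $\mathsf{f}v_i=\frac{q^{i+1}-q^{-i-1}}{q-q^{-1}}v_{i+1}$. *)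

theory Defs
  imports
    "HOL-Library.Poly_Mapping"
    "HOL-Library.Product_Plus"
    "HOL-Algebra.QuotRing"
    "Jordan_Normal_Form.VS_Connect"
begin

hide_const (open) Modules.module_hom

section \<open>Algebras given by generators and relations\<close>

text \<open>The free algebra over the complex numbers on a set of generators is the monoid algebra of
  the free monoid; words get their own type so that concatenation can be the additive monoid
  operation from which \<^typ>\<open>'k \<Rightarrow>\<^sub>0 complex\<close> derives its multiplication.\<close>

datatype 'g word = Word (letters: "'g list")

instantiation word :: (type) monoid_add
begin

definition zero_word :: "'a word" where
  "0 = Word []"

definition plus_word :: "'a word \<Rightarrow> 'a word \<Rightarrow> 'a word" where
  "u + v = Word (letters u @ letters v)"

instance
  by standard (simp_all add: zero_word_def plus_word_def)

end

type_synonym 'g free_alg = "'g word \<Rightarrow>\<^sub>0 complex"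

definition gen :: "'g \<Rightarrow> 'g free_alg" where
  "gen g = Poly_Mapping.single (Word [g]) 1"

definition scale :: "complex \<Rightarrow> ('k \<Rightarrow>\<^sub>0 complex) \<Rightarrow> ('k \<Rightarrow>\<^sub>0 complex)" where
  "scale c p = Poly_Mapping.map (\<lambda>z. c * z) p"

definition relation_ideal :: "'g free_alg set \<Rightarrow> 'g free_alg set" where
  "relation_ideal R = Idl\<^bsub>class_ring\<^esub> R"

definition residue :: "'g free_alg set \<Rightarrow> 'g free_alg \<Rightarrow> 'g free_alg set" where
  "residue R p = relation_ideal R +>\<^bsub>class_ring\<^esub> p"

text \<open>The record \<^typ>\<open>('r, 'a) module\<close> carries all operations of an algebra. The first five fields
  are those of the quotient ring; scalar multiplication is induced on cosets in the same way as
  the multiplication of \<^const>\<open>FactRing\<close>.\<close>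

definition presented_algebra :: "'g free_alg set \<Rightarrow> (complex, 'g free_alg set) module" where
  "presented_algebra R =
    (let Q = class_ring Quot relation_ideal R in
      \<lparr>carrier = carrier Q, mult = mult Q, one = one Q, zero = zero Q, add = add Q,
       smult = (\<lambda>c X. \<Union>p\<in>X. residue R (scale c p))\<rparr>)"

text \<open>The algebra homomorphism from the free algebra determined by the images \<open>\<phi>\<close> of the generators;
  \<open>\<iota>\<close> is the structure map of the target algebra.\<close>

definition free_lift :: "(complex \<Rightarrow> 'b::ring_1) \<Rightarrow> ('g \<Rightarrow> 'b) \<Rightarrow> 'g free_alg \<Rightarrow> 'b" where
  "free_lift \<iota> \<phi> p =
    (\<Sum>w\<in>Poly_Mapping.keys p. \<iota> (Poly_Mapping.lookup p w) * prod_list (map \<phi> (letters w)))"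

text \<open>The same for operators on a space of finitely supported functions.\<close>

definition free_operator ::
  "('g \<Rightarrow> ('k \<Rightarrow>\<^sub>0 complex) \<Rightarrow> ('k \<Rightarrow>\<^sub>0 complex)) \<Rightarrow> 'g free_alg \<Rightarrow> ('k \<Rightarrow>\<^sub>0 complex) \<Rightarrow> ('k \<Rightarrow>\<^sub>0 complex)"
where
  "free_operator \<rho> p v =
    (\<Sum>w\<in>Poly_Mapping.keys p. scale (Poly_Mapping.lookup p w) (foldr \<rho> (letters w) v))"


section \<open>The Hopf algebra \<open>U\<^sub>q(sl\<^sub>2)\<close>\<close>

datatype uq_gen = gk | gki | ge | gf

definition uq_relators :: "complex \<Rightarrow> uq_gen free_alg set" where
  "uq_relators q =
    {gen gki * gen gk - 1,
     gen gk * gen gki - 1,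
     gen gk * gen ge - scale (q powi 2) (gen ge * gen gk),
     gen gk * gen gf - scale (q powi (-2)) (gen gf * gen gk),
     gen ge * gen gf - gen gf * gen ge - scale (1 / (q - inverse q)) (gen gk - gen gki)}"

definition Uq :: "complex \<Rightarrow> (complex, uq_gen free_alg set) module" where
  "Uq q = presented_algebra (uq_relators q)"

definition uq_class :: "complex \<Rightarrow> uq_gen free_alg \<Rightarrow> uq_gen free_alg set" where
  "uq_class q p = residue (uq_relators q) p"

text \<open>The tensor square of a free algebra is the monoid algebra of the product of two copies of the
  free monoid. With \<open>I\<close> the ideal of relations of \<open>U\<^sub>q(sl\<^sub>2)\<close>, the algebra \<open>U\<^sub>q(sl\<^sub>2) \<otimes> U\<^sub>q(sl\<^sub>2)\<close> is the
  quotient of this tensor square by \<open>I \<otimes> 1\<close> and \<open>1 \<otimes> I\<close>.\<close>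

type_synonym uq_free2 = "(uq_gen word \<times> uq_gen word) \<Rightarrow>\<^sub>0 complex"

definition tensor :: "uq_gen free_alg \<Rightarrow> uq_gen free_alg \<Rightarrow> uq_free2" where
  "tensor p r = (\<Sum>u\<in>Poly_Mapping.keys p. \<Sum>v\<in>Poly_Mapping.keys r.
     Poly_Mapping.single (u, v) (Poly_Mapping.lookup p u * Poly_Mapping.lookup r v))"

definition uq2_ideal :: "complex \<Rightarrow> uq_free2 set" where
  "uq2_ideal q = Idl\<^bsub>class_ring\<^esub>
     ((\<lambda>r. tensor r 1) ` uq_relators q \<union> (\<lambda>r. tensor 1 r) ` uq_relators q)"

text \<open>The value at \<open>k\<inverse>\<close> is forced by multiplicativity.\<close>

fun comult_gen :: "uq_gen \<Rightarrow> uq_free2" where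
  "comult_gen gk = tensor (gen gk) (gen gk)"
| "comult_gen gki = tensor (gen gki) (gen gki)"
| "comult_gen ge = tensor 1 (gen ge) + tensor (gen ge) (gen gk)"
| "comult_gen gf = tensor (gen gf) 1 + tensor (gen gki) (gen gf)"

fun counit_gen :: "uq_gen \<Rightarrow> complex" where
  "counit_gen gk = 1"
| "counit_gen gki = 1"
| "counit_gen ge = 0"
| "counit_gen gf = 0"

text \<open>Comultiplication and counit act on elements of \<^const>\<open>Uq\<close>, i.e. on cosets.\<close>

definition comult :: "complex \<Rightarrow> uq_gen free_alg set \<Rightarrow> uq_free2 set" where
  "comult q h = (\<Union>p\<in>h. uq2_ideal q +>\<^bsub>class_ring\<^esub>
     free_lift (Poly_Mapping.single 0) comult_gen p)"

definition counit :: "uq_gen free_alg set \<Rightarrow> complex" where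
  "counit h = the_elem (free_lift (\<lambda>c. c) counit_gen ` h)"


section \<open>Modules and module algebras over \<open>U\<^sub>q(sl\<^sub>2)\<close>\<close>

record 'v uq_module = "(complex, 'v) module" +
  act :: "uq_gen free_alg set \<Rightarrow> 'v \<Rightarrow> 'v"

text \<open>The fields \<^const>\<open>mult\<close> and \<^const>\<open>one\<close> of the record are irrelevant here; they are used for module
  algebras only.\<close>

locale uq_module = vectorspace class_ring M
  for q :: complex and M :: "('v, 'm) uq_module_scheme" (structure) +
  assumes act_linear: "h \<in> carrier (Uq q) \<Longrightarrow> act M h \<in> module_hom class_ring M M"
    and act_add: "\<lbrakk>g \<in> carrier (Uq q); h \<in> carrier (Uq q); v \<in> carrier M\<rbrakk> \<Longrightarrow>
      act M (g \<oplus>\<^bsub>Uq q\<^esub> h) v = act M g v \<oplus> act M h v"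
    and act_smult: "\<lbrakk>h \<in> carrier (Uq q); v \<in> carrier M\<rbrakk> \<Longrightarrow>
      act M (c \<odot>\<^bsub>Uq q\<^esub> h) v = c \<odot> act M h v"
    and act_mult: "\<lbrakk>g \<in> carrier (Uq q); h \<in> carrier (Uq q); v \<in> carrier M\<rbrakk> \<Longrightarrow>
      act M (g \<otimes>\<^bsub>Uq q\<^esub> h) v = act M g (act M h v)"
    and act_one: "v \<in> carrier M \<Longrightarrow> act M \<one>\<^bsub>Uq q\<^esub> v = v"

text \<open>A representative \<open>t\<close> of \<open>\<Delta>(h)\<close> is a linear combination of pairs of words
  \<open>(u, v)\<close> and exhibits \<open>\<Delta>(h)\<close> as the sum of the tensors \<open>t(u, v) u \<otimes> v\<close>.\<close>

locale uq_module_algebra = uq_module q M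
  for q :: complex and M :: "('v, 'm) uq_module_scheme" (structure) +
  assumes act_product: "\<lbrakk>h \<in> carrier (Uq q); t \<in> comult q h; a \<in> carrier M; b \<in> carrier M\<rbrakk> \<Longrightarrow>
      act M h (a \<otimes> b) =
        (\<Oplus>w\<in>Poly_Mapping.keys t. Poly_Mapping.lookup t w \<odot>
          (act M (uq_class q (Poly_Mapping.single (fst w) 1)) a \<otimes>
           act M (uq_class q (Poly_Mapping.single (snd w) 1)) b))"
    and act_unit: "h \<in> carrier (Uq q) \<Longrightarrow> act M h \<one> = counit h \<odot> \<one>"

definition with_action ::
  "(complex, 'v) module \<Rightarrow> (uq_gen free_alg set \<Rightarrow> 'v \<Rightarrow> 'v) \<Rightarrow> 'v uq_module" where
  "with_action A \<pi> = \<lparr>carrier = carrier A, mult = mult A, one = one A, zero = zero A, add = add A,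
     smult = smult A, act = \<pi>\<rparr>"

text \<open>A submodule is a subset; as a module in its own right it is \<open>M\<lparr>carrier := W\<rparr>\<close>.\<close>

definition uq_submodule ::
  "complex \<Rightarrow> 'v set \<Rightarrow> ('v, 'm) uq_module_scheme \<Rightarrow> bool" where
  "uq_submodule q W M \<longleftrightarrow>
     submodule class_ring W M \<and> (\<forall>h\<in>carrier (Uq q). \<forall>w\<in>W. act M h w \<in> W)"

definition uq_quotient ::
  "('v, 'm) uq_module_scheme \<Rightarrow> 'v set \<Rightarrow> 'v set uq_module" where
  "uq_quotient M J = \<lparr>carrier = a_rcosets\<^bsub>M\<^esub> J, mult = undefined, one = undefined,
     zero = J, add = set_add M,
     smult = (\<lambda>c X. \<Union>x\<in>X. J +>\<^bsub>M\<^esub> (c \<odot>\<^bsub>M\<^esub> x)),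
     act = (\<lambda>h X. \<Union>x\<in>X. J +>\<^bsub>M\<^esub> act M h x)\<rparr>"

definition uq_isomorphic ::
  "complex \<Rightarrow> ('v, 'm) uq_module_scheme \<Rightarrow> ('w, 'n) uq_module_scheme \<Rightarrow> bool" where
  "uq_isomorphic q M N \<longleftrightarrow> uq_module q M \<and> uq_module q N \<and>
     (\<exists>\<phi>\<in>module_hom class_ring M N. bij_betw \<phi> (carrier M) (carrier N) \<and>
        (\<forall>h\<in>carrier (Uq q). \<forall>v\<in>carrier M. \<phi> (act M h v) = act N h (\<phi> v)))"

definition uq_simple :: "complex \<Rightarrow> ('v, 'm) uq_module_scheme \<Rightarrow> bool" where
  "uq_simple q M \<longleftrightarrow> uq_module q M \<and> carrier M \<noteq> {\<zero>\<^bsub>M\<^esub>} \<and>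
     (\<forall>W. uq_submodule q W M \<longrightarrow> W = {\<zero>\<^bsub>M\<^esub>} \<or> W = carrier M)"

definition composition_series ::
  "complex \<Rightarrow> ('v, 'm) uq_module_scheme \<Rightarrow> 'v set list \<Rightarrow> bool" where
  "composition_series q M Ns \<longleftrightarrow>
     Ns \<noteq> [] \<and> hd Ns = {\<zero>\<^bsub>M\<^esub>} \<and> last Ns = carrier M \<and>
     (\<forall>N\<in>set Ns. uq_submodule q N M) \<and>
     (\<forall>i. Suc i < length Ns \<longrightarrow> Ns ! i \<subset> Ns ! Suc i \<and>
        uq_simple q (uq_quotient (M\<lparr>carrier := Ns ! Suc i\<rparr>) (Ns ! i)))"

definition uq_direct_sum ::
  "complex \<Rightarrow> ('v, 'm) uq_module_scheme \<Rightarrow> ('i \<Rightarrow> 'v set) \<Rightarrow> bool" where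
  "uq_direct_sum q M V \<longleftrightarrow> (\<forall>i. uq_submodule q (V i) M) \<and>
     (\<forall>v\<in>carrier M. \<exists>!u. (\<forall>i. u i \<in> V i) \<and> finite {i. u i \<noteq> \<zero>\<^bsub>M\<^esub>} \<and>
        v = (\<Oplus>\<^bsub>M\<^esub>i\<in>{i. u i \<noteq> \<zero>\<^bsub>M\<^esub>}. u i))"

definition uq_direct_summand ::
  "complex \<Rightarrow> 'v set \<Rightarrow> ('v, 'm) uq_module_scheme \<Rightarrow> bool" where
  "uq_direct_summand q J M \<longleftrightarrow> uq_submodule q J M \<and>
     (\<exists>W. uq_submodule q W M \<and> J <+>\<^bsub>M\<^esub> W = carrier M \<and> J \<inter> W = {\<zero>\<^bsub>M\<^esub>})"


section \<open>Modules given by the action of the generators on a basis\<close>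

text \<open>The space has basis \<open>v\<^sub>i\<close> for \<open>i \<in> S\<close>, and \<open>b g i\<close> is the image of \<open>v\<^sub>i\<close> under the generator \<open>g\<close>.
  When the operators satisfy the relations, the image of a coset \<open>h\<close> below is a singleton.\<close>

definition basis_module ::
  "'k set \<Rightarrow> (uq_gen \<Rightarrow> 'k \<Rightarrow> ('k \<Rightarrow>\<^sub>0 complex)) \<Rightarrow> ('k \<Rightarrow>\<^sub>0 complex) uq_module" where
  "basis_module S b = \<lparr>carrier = {v. Poly_Mapping.keys v \<subseteq> S}, mult = undefined, one = undefined,
     zero = 0, add = (+), smult = scale,
     act = (\<lambda>h v. the_elem ((\<lambda>p. free_operator
       (\<lambda>g w. \<Sum>i\<in>Poly_Mapping.keys w. scale (Poly_Mapping.lookup w i) (b g i)) p v) ` h))\<rparr>"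

text \<open>Only the values at \<open>i \<le> n\<close> matter below.\<close>

fun V1_gen :: "complex \<Rightarrow> nat \<Rightarrow> uq_gen \<Rightarrow> nat \<Rightarrow> (nat \<Rightarrow>\<^sub>0 complex)" where
  "V1_gen q n gk i = Poly_Mapping.single i (q powi (int n - 2 * int i))"
| "V1_gen q n gki i = Poly_Mapping.single i (q powi (2 * int i - int n))"
| "V1_gen q n ge i = (if i = 0 then 0 else Poly_Mapping.single (i - 1)
     ((q powi (int n - int i + 1) - q powi (- (int n - int i + 1))) / (q - inverse q)))"
| "V1_gen q n gf i = (if i < n then Poly_Mapping.single (i + 1)
     ((q powi (int i + 1) - q powi (- int i - 1)) / (q - inverse q)) else 0)"

definition V1 :: "complex \<Rightarrow> nat \<Rightarrow> (nat \<Rightarrow>\<^sub>0 complex) uq_module" where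
  "V1 q n = basis_module {..n} (V1_gen q n)"

fun verma_gen :: "complex \<Rightarrow> complex \<Rightarrow> uq_gen \<Rightarrow> nat \<Rightarrow> (nat \<Rightarrow>\<^sub>0 complex)" where
  "verma_gen q lam gk i = Poly_Mapping.single i (lam * q powi (- 2 * int i))"
| "verma_gen q lam gki i = Poly_Mapping.single i (inverse lam * q powi (2 * int i))"
| "verma_gen q lam ge 0 = 0"
| "verma_gen q lam ge (Suc i) = Poly_Mapping.single i
     ((lam * q powi (- int i) - inverse lam * q powi (int i)) / (q - inverse q))"
| "verma_gen q lam gf i = Poly_Mapping.single (i + 1)
     ((q powi (int i + 1) - q powi (- int i - 1)) / (q - inverse q))"

definition verma :: "complex \<Rightarrow> complex \<Rightarrow> (nat \<Rightarrow>\<^sub>0 complex) uq_module" where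
  "verma q lam = basis_module UNIV (verma_gen q lam)"


section \<open>The quantum plane\<close>

datatype qp_gen = gx | gy

definition qp_relators :: "complex \<Rightarrow> qp_gen free_alg set" where
  "qp_relators q = {gen gy * gen gx - scale q (gen gx * gen gy)}"

definition qplane :: "complex \<Rightarrow> (complex, qp_gen free_alg set) module" where
  "qplane q = presented_algebra (qp_relators q)"

definition qp_x :: "complex \<Rightarrow> qp_gen free_alg set" where
  "qp_x q = residue (qp_relators q) (gen gx)"

definition qp_y :: "complex \<Rightarrow> qp_gen free_alg set" where
  "qp_y q = residue (qp_relators q) (gen gy)"

definition poly_y :: "complex \<Rightarrow> qp_gen free_alg set set" where
  "poly_y q = LinearCombinations.module.span class_ring (qplane q) (range (\<lambda>p::nat. qp_y q [^]\<^bsub>qplane q\<^esub> p))"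

definition qp_V :: "complex \<Rightarrow> nat \<Rightarrow> qp_gen free_alg set set" where
  "qp_V q n = (\<lambda>a. (qp_x q [^]\<^bsub>qplane q\<^esub> n) \<otimes>\<^bsub>qplane q\<^esub> a) ` poly_y q"

definition qp_J :: "complex \<Rightarrow> nat \<Rightarrow> qp_gen free_alg set set" where
  "qp_J q n = LinearCombinations.module.span class_ring (qplane q)
     ((\<lambda>p::nat. (qp_x q [^]\<^bsub>qplane q\<^esub> n) \<otimes>\<^bsub>qplane q\<^esub> (qp_y q [^]\<^bsub>qplane q\<^esub> p)) ` {..n})"

end

theory Submission
  imports Defs
begin

text \<open>The product rule turns the prescribed values on \<open>x\<close> and \<open>y\<close> into closed formulas on the
  monomial basis. With \<open>[k] = (q\<^sup>k - q\<^sup>-\<^sup>k) / (q - q\<^sup>-\<^sup>1)\<close>, the action multiplies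
  \<open>x\<^sup>n y\<^sup>p\<close> by \<open>q\<close> to the power \<open>n - 2p\<close> under \<open>k\<close>, sends it to a nonzero multiple of
  \<open>[p] x\<^sup>n y\<^sup>p\<^sup>-\<^sup>1\<close> under \<open>e\<close>, and to a nonzero multiple of \<open>[n - p] x\<^sup>n y\<^sup>p\<^sup>+\<^sup>1\<close> under \<open>f\<close>
  (lemma \<open>gact_monomial\<close>). Everything can be read off from this.

  The exponent of \<open>x\<close> never changes, so the plane is the direct sum of the \<open>x\<^sup>n \<complex>[y]\<close>. Inside one
  such summand the vectors \<open>x\<^sup>n y\<^sup>p\<close> form a ladder on which \<open>e\<close> steps down and \<open>f\<close> steps up. As
  \<open>q\<close> is not a root of unity, \<open>[k]\<close> vanishes for \<open>k = 0\<close> only; hence \<open>e\<close> kills nothing but the bottom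
  rung \<open>p = 0\<close>, and \<open>f\<close> kills nothing but the rung \<open>p = n\<close>. The first \<open>n + 1\<close> rungs therefore span a
  submodule. A diagonal rescaling of the rungs identifies it with the simple module of highest
  weight \<open>q\<^sup>n\<close>, and dropping these rungs and rescaling the others maps the summand onto a Verma
  module with this submodule as kernel (\<open>V1_intertwine\<close>, \<open>verma_intertwine\<close>).

  One observation yields both the simplicity of the two factors and the indecomposability: a
  nonzero subspace that is stable under \<open>e\<close> contains the bottom rung, because \<open>e\<close> can be applied to
  any of its vectors until only that rung is left (\<open>lowering_reaches_bottom\<close>). When \<open>f\<close> climbs from
  the bottom to the top without a break, nothing proper can be stable; and in \<open>x\<^sup>n \<complex>[y]\<close> two
  nonzero submodules always share \<open>x\<^sup>n\<close>, so no complement of the finite-dimensional one exists.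

  Two foundational facts need an argument of their own. The monomials are linearly independent in the
  quantum plane because the free algebra acts on formal combinations of monomials in a way that
  respects the relation, and a monomial applied to the unit returns itself (\<open>qp_nf_monomial\<close>). And
  the modules given by formulas on a basis do satisfy the relations of \<open>U\<^sub>q(sl\<^sub>2)\<close>, because each of
  them is a linear image of a module that is already at hand (\<open>basis_module_image\<close>).\<close>

section \<open>Linear extension from a basis\<close>

text \<open>The building block of all concrete maps below: \<^const>\<open>free_operator\<close>, the operators of a
  \<^const>\<open>basis_module\<close>, the monomial expansion in the quantum plane and every change of basis are of
  this form. Identities between such maps reduce to identities on basis vectors.\<close>

definition lin :: "('i \<Rightarrow> ('k \<Rightarrow>\<^sub>0 complex)) \<Rightarrow> ('i \<Rightarrow>\<^sub>0 complex) \<Rightarrow> ('k \<Rightarrow>\<^sub>0 complex)" where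
  "lin b w = (\<Sum>i\<in>Poly_Mapping.keys w. scale (Poly_Mapping.lookup w i) (b i))"

lemma lookup_scale [simp]: "Poly_Mapping.lookup (scale c p) k = c * Poly_Mapping.lookup p k"
  unfolding scale_def by (simp add: Poly_Mapping.map.rep_eq when_def)

lemma scale_simps [simp]:
  "scale c 0 = 0" "scale 0 p = 0" "scale 1 p = p" "scale c (scale d p) = scale (c * d) p"
  by (rule poly_mapping_eqI; simp)+

lemma scale_add: "scale c (p + r) = scale c p + scale c r"
  by (rule poly_mapping_eqI) (simp add: lookup_add algebra_simps)

lemma scale_add_left: "scale (c + d) p = scale c p + scale d p"
  by (rule poly_mapping_eqI) (simp add: lookup_add algebra_simps)

lemma scale_diff: "scale c (p - r) = scale c p - scale c r"
  by (rule poly_mapping_eqI) (simp add: lookup_minus algebra_simps)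

lemma scale_single [simp]: "scale c (Poly_Mapping.single i a) = Poly_Mapping.single i (c * a)"
  by (rule poly_mapping_eqI) (simp add: lookup_single when_def)

lemma scale_conv_mult: "scale c p = Poly_Mapping.single 0 c * p"
  unfolding scale_def by (rule mult_map_scale_conv_mult)

lemma poly_mapping_induct [case_names zero add]:
  assumes "P 0"
    and "\<And>i c u. \<lbrakk>i \<notin> Poly_Mapping.keys u; c \<noteq> 0; P u\<rbrakk> \<Longrightarrow> P (Poly_Mapping.single i c + u)"
  shows "P u"
proof (induction u rule: update_induct)
  case const
  show ?case by (rule assms(1))
next
  case (update u i c)
  have "Poly_Mapping.update i c u = Poly_Mapping.single i c + u"
    using update(1)
    by (intro poly_mapping_eqI)
      (auto simp: lookup_update lookup_add lookup_single when_def in_keys_iff)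
  then show ?case using assms(2)[OF update] by simp
qed

text \<open>Scalars are central although the free algebra is not commutative: \<open>c\<close> times the empty word
  commutes with every word.\<close>

lemma scale_commute_mult: "p * scale c r = scale c (p * r)"
proof -
  have "p * Poly_Mapping.single 0 c = Poly_Mapping.single 0 c * p"
    by (induction p rule: poly_mapping_induct)
      (simp_all add: distrib_left distrib_right mult_single mult.commute)
  then show ?thesis by (metis scale_conv_mult mult.assoc)
qed

lemma scale_mult: "scale c p * r = scale c (p * r)"
  by (simp add: scale_conv_mult mult.assoc)

lemma lookup_lin_superset:
  assumes "finite S" "Poly_Mapping.keys w \<subseteq> S"
  shows "Poly_Mapping.lookup (lin b w) j = (\<Sum>i\<in>S. Poly_Mapping.lookup w i * Poly_Mapping.lookup (b i) j)"
proof -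
  have "Poly_Mapping.lookup (lin b w) j
      = (\<Sum>i\<in>Poly_Mapping.keys w. Poly_Mapping.lookup w i * Poly_Mapping.lookup (b i) j)"
    by (simp add: lin_def lookup_sum)
  also have "\<dots> = (\<Sum>i\<in>S. Poly_Mapping.lookup w i * Poly_Mapping.lookup (b i) j)"
    using assms by (intro sum.mono_neutral_left) (auto simp: in_keys_iff)
  finally show ?thesis .
qed

lemmas lookup_lin = lookup_lin_superset[OF finite_keys subset_refl]

lemma lin_add: "lin b (v + w) = lin b v + lin b w"
proof (rule poly_mapping_eqI)
  fix j
  let ?S = "Poly_Mapping.keys v \<union> Poly_Mapping.keys w"
  have "finite ?S" by simp
  moreover have "Poly_Mapping.keys (v + w) \<subseteq> ?S" by (rule keys_add)
  ultimately show "Poly_Mapping.lookup (lin b (v + w)) j = Poly_Mapping.lookup (lin b v + lin b w) j"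
    unfolding lookup_add
    by (simp only: lookup_lin_superset[of ?S] Un_upper1 Un_upper2 lookup_add sum.distrib distrib_right)
qed

lemma lin_scale: "lin b (scale c w) = scale c (lin b w)"
proof (rule poly_mapping_eqI)
  fix j
  have "Poly_Mapping.keys (scale c w) \<subseteq> Poly_Mapping.keys w"
    by (auto simp: in_keys_iff)
  then show "Poly_Mapping.lookup (lin b (scale c w)) j = Poly_Mapping.lookup (scale c (lin b w)) j"
    by (simp add: lookup_lin_superset[of "Poly_Mapping.keys w"] sum_distrib_left mult.assoc)
qed

lemma lin_single [simp]: "lin b (Poly_Mapping.single i c) = scale c (b i)"
  by (simp add: lin_def)

lemma lin_zero [simp]: "lin b 0 = 0"
  by (simp add: lin_def)

lemma lin_diff: "lin b (v - w) = lin b v - lin b w"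
  using lin_add[of b "v - w" w] by simp

lemma linear_eq_lin:
  assumes add: "\<And>u v. T (u + v) = T u + T v" and sc: "\<And>c u. T (scale c u) = scale c (T u)"
  shows "T w = lin (\<lambda>i. T (Poly_Mapping.single i 1)) w"
proof (induction w rule: poly_mapping_induct)
  case zero
  show ?case using sc[of 0 0] by simp
next
  case (add i c u)
  then show ?case using assms(1) sc[of c "Poly_Mapping.single i 1"] by (simp add: lin_add)
qed

lemma lin_compose:
  assumes add: "\<And>u v. T (u + v) = T u + T v" and sc: "\<And>c u. T (scale c u) = scale c (T u)"
  shows "T (lin b w) = lin (\<lambda>i. T (b i)) w"
  using linear_eq_lin[of "\<lambda>w. T (lin b w)" w] by (simp add: lin_add lin_scale assms)

lemma lin_single_id [simp]: "lin (\<lambda>i. Poly_Mapping.single i 1) w = w"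
  by (rule linear_eq_lin[of "\<lambda>w. w", symmetric]) simp_all

lemma lin_cong: "(\<And>i. i \<in> Poly_Mapping.keys w \<Longrightarrow> b i = b' i) \<Longrightarrow> lin b w = lin b' w"
  unfolding lin_def by (intro sum.cong) auto

lemma keys_lin:
  assumes "\<And>i. i \<in> Poly_Mapping.keys w \<Longrightarrow> Poly_Mapping.keys (b i) \<subseteq> T"
  shows "Poly_Mapping.keys (lin b w) \<subseteq> T"
proof
  fix j assume "j \<in> Poly_Mapping.keys (lin b w)"
  then have "(\<Sum>i\<in>Poly_Mapping.keys w. Poly_Mapping.lookup w i * Poly_Mapping.lookup (b i) j) \<noteq> 0"
    by (simp add: in_keys_iff lookup_lin)
  then obtain i where "i \<in> Poly_Mapping.keys w" "Poly_Mapping.lookup (b i) j \<noteq> 0"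
    by (metis (mono_tags, lifting) mult_eq_0_iff sum.neutral)
  then show "j \<in> T" using assms[of i] by (meson in_keys_iff subsetD)
qed

lemma lin_lin: "lin a (lin b w) = lin (\<lambda>i. lin a (b i)) w"
  by (rule lin_compose) (simp_all add: lin_add lin_scale)

lemma lookup_diagonal: "Poly_Mapping.lookup (lin (\<lambda>i. Poly_Mapping.single i (c i)) w) j = c j * Poly_Mapping.lookup w j"
  by (induction w rule: poly_mapping_induct) (auto simp: lin_add lookup_add lookup_single when_def algebra_simps)

text \<open>The map that drops the first \<open>s\<close> basis vectors and rescales the others; it is used to cut a
  ladder above one of its rungs.\<close>

lemma lookup_shift:
  fixes s :: nat
  shows
  "Poly_Mapping.lookup (lin (\<lambda>i. if i < s then 0 else Poly_Mapping.single (i - s) (d (i - s))) w) j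
    = d j * Poly_Mapping.lookup w (s + j)"
proof -
  have "Poly_Mapping.lookup (if i < s then 0 else Poly_Mapping.single (i - s) (d (i - s))) j
      = (if i = s + j then d j else 0)" for i
    by (auto simp: lookup_single when_def)
  then show ?thesis by (simp add: lookup_lin in_keys_iff if_distrib[of "\<lambda>x. _ * x"] cong: if_cong)
qed

section \<open>Words in operators given on a basis\<close>

lemma free_operator_eq_lin: "free_operator \<rho> p v = lin (\<lambda>w. foldr \<rho> (letters w) v) p"
  by (simp add: free_operator_def lin_def)

lemma foldr_lin_add: "foldr (\<lambda>g. lin (b g)) ws (u + v) = foldr (\<lambda>g. lin (b g)) ws u + foldr (\<lambda>g. lin (b g)) ws v"
  by (induction ws) (simp_all add: lin_add)

lemma foldr_lin_scale: "foldr (\<lambda>g. lin (b g)) ws (scale c v) = scale c (foldr (\<lambda>g. lin (b g)) ws v)"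
  by (induction ws) (simp_all add: lin_scale)

lemma free_operator_simps:
  "free_operator \<rho> 0 v = 0"
  "free_operator \<rho> (p + r) v = free_operator \<rho> p v + free_operator \<rho> r v"
  "free_operator \<rho> (p - r) v = free_operator \<rho> p v - free_operator \<rho> r v"
  "free_operator \<rho> (scale c p) v = scale c (free_operator \<rho> p v)"
  "free_operator \<rho> (Poly_Mapping.single w c) v = scale c (foldr \<rho> (letters w) v)"
  "free_operator \<rho> (gen g) v = \<rho> g v"
  "free_operator \<rho> 1 v = v"
proof -
  show "free_operator \<rho> 1 v = v"
    unfolding single_one[symmetric] free_operator_eq_lin lin_single by (simp add: zero_word_def)
qed (simp_all add: free_operator_eq_lin lin_add lin_diff lin_scale gen_def)

lemma free_operator_uminus: "free_operator \<rho> (- p) v = - free_operator \<rho> p v"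
  using free_operator_simps(3)[of \<rho> 0 p v] by (simp add: free_operator_simps)

lemma free_operator_lin:
  "free_operator (\<lambda>g. lin (b g)) p (u + v) = free_operator (\<lambda>g. lin (b g)) p u + free_operator (\<lambda>g. lin (b g)) p v"
  "free_operator (\<lambda>g. lin (b g)) p (scale c v) = scale c (free_operator (\<lambda>g. lin (b g)) p v)"
  by (induction p rule: poly_mapping_induct)
    (simp_all add: free_operator_simps foldr_lin_add foldr_lin_scale scale_add mult.commute)

text \<open>Substituting linear operators for the letters is an algebra homomorphism. Linearity of the
  operators is built in by taking them of the form \<^term>\<open>lin (b g)\<close>.\<close>

lemma free_operator_mult:
  "free_operator (\<lambda>g. lin (b g)) (p * r) v = free_operator (\<lambda>g. lin (b g)) p (free_operator (\<lambda>g. lin (b g)) r v)"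
proof (induction p rule: poly_mapping_induct)
  case zero
  show ?case by (simp add: free_operator_simps)
next
  case (add w c p)
  let ?F = "free_operator (\<lambda>g. lin (b g))"
  have "?F (Poly_Mapping.single w c * r) v = scale c (foldr (\<lambda>g. lin (b g)) (letters w) (?F r v))"
  proof (induction r rule: poly_mapping_induct)
    case zero
    show ?case using foldr_lin_scale[of b "letters w" 0 0] by (simp add: free_operator_simps)
  next
    case (add w' c' r)
    then show ?case
      by (simp add: distrib_left free_operator_simps mult_single plus_word_def foldr_lin_add
          foldr_lin_scale scale_add)
  qed
  then show ?case using add.IH by (simp add: distrib_right free_operator_simps)
qed

section \<open>Presented algebras\<close>

lemma ideal_relation_ideal: "ideal (relation_ideal R) (class_ring :: 'g free_alg ring)"
  unfolding relation_ideal_def by (rule ring.genideal_ideal[OF class_ring.ring_axioms]) simp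

lemma relators_in_ideal: "r \<in> R \<Longrightarrow> r \<in> relation_ideal R"
  unfolding relation_ideal_def using ring.genideal_self[OF class_ring.ring_axioms, of R] by auto

lemma relation_ideal_minimal: "\<lbrakk>ideal K class_ring; R \<subseteq> K\<rbrakk> \<Longrightarrow> relation_ideal R \<subseteq> K"
  unfolding relation_ideal_def by (rule ring.genideal_minimal[OF class_ring.ring_axioms])

lemma ideal_closed:
  assumes "ideal I (class_ring :: 'a::ring_1 ring)"
  shows "0 \<in> I" "\<lbrakk>a \<in> I; b \<in> I\<rbrakk> \<Longrightarrow> a + b \<in> I" "a \<in> I \<Longrightarrow> x * a \<in> I" "a \<in> I \<Longrightarrow> a * x \<in> I"
    "a \<in> I \<Longrightarrow> - a \<in> I"
proof -
  interpret ideal I "class_ring :: 'a ring" by fact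
  show "0 \<in> I" using zero_closed by simp
  show "\<lbrakk>a \<in> I; b \<in> I\<rbrakk> \<Longrightarrow> a + b \<in> I" using a_closed[of a b] by simp
  show l: "a \<in> I \<Longrightarrow> x * a \<in> I" for x using I_l_closed[of a x] by simp
  show "a \<in> I \<Longrightarrow> a * x \<in> I" using I_r_closed[of a x] by simp
  show "a \<in> I \<Longrightarrow> - a \<in> I" using l[of "-1"] by simp
qed

lemma mem_class_coset: "p' \<in> I +>\<^bsub>class_ring\<^esub> p \<longleftrightarrow> p' - p \<in> (I :: 'a::ring_1 set)"
proof -
  have "p' \<in> I +>\<^bsub>class_ring\<^esub> p \<longleftrightarrow> (\<exists>i\<in>I. p' = i + p)"
    by (auto simp: a_r_coset_def r_coset_def)
  also have "\<dots> \<longleftrightarrow> p' - p \<in> I"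
    by (auto intro: bexI[of _ "p' - p"])
  finally show ?thesis .
qed

lemma mem_residue: "p' \<in> residue R p \<longleftrightarrow> p' - p \<in> relation_ideal R"
  unfolding residue_def by (rule mem_class_coset)

lemma self_mem_residue [simp]: "p \<in> residue R p"
  by (simp add: mem_residue ideal_closed[OF ideal_relation_ideal])

lemma residue_eq_iff: "residue R p = residue R p' \<longleftrightarrow> p - p' \<in> relation_ideal R"
proof
  assume "residue R p = residue R p'"
  then show "p - p' \<in> relation_ideal R" using self_mem_residue mem_residue by blast
next
  note I = ideal_closed[OF ideal_relation_ideal[of R]]
  assume d: "p - p' \<in> relation_ideal R"
  show "residue R p = residue R p'"
  proof (rule Set.set_eqI)
    fix r
    have "(r - p) + (p - p') = r - p'" "(r - p') + - (p - p') = r - p" by simp_all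
    then show "r \<in> residue R p \<longleftrightarrow> r \<in> residue R p'"
      unfolding mem_residue using I(2)[OF _ d, of "r - p"] I(2)[OF _ I(5)[OF d], of "r - p'"] by auto
  qed
qed

lemma residue_eqI: "p' \<in> residue R p \<Longrightarrow> residue R p' = residue R p"
  by (simp add: mem_residue residue_eq_iff)

lemma scale_ideal: "p \<in> relation_ideal R \<Longrightarrow> scale c p \<in> relation_ideal R"
  unfolding scale_conv_mult by (rule ideal_closed[OF ideal_relation_ideal])

lemma UN_residue:
  assumes "\<And>p'. p' \<in> residue R p \<Longrightarrow> F p' = F p"
  shows "(\<Union>p'\<in>residue R p. F p') = F p"
  using assms self_mem_residue by blast

text \<open>All operations on cosets are computed on representatives. For the scalar multiplication this
  uses that an ideal is stable under scalars, since \<open>c p\<close> is the product of \<open>p\<close> with \<open>c 1\<close>.\<close>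

lemma presented_algebra_simps:
  "carrier (presented_algebra R) = range (residue R)"
  "\<one>\<^bsub>presented_algebra R\<^esub> = residue R 1"
  "\<zero>\<^bsub>presented_algebra R\<^esub> = residue R 0"
  "residue R p \<oplus>\<^bsub>presented_algebra R\<^esub> residue R r = residue R (p + r)"
  "residue R p \<otimes>\<^bsub>presented_algebra R\<^esub> residue R r = residue R (p * r)"
  "c \<odot>\<^bsub>presented_algebra R\<^esub> residue R p = residue R (scale c p)"
proof -
  interpret I: ideal "relation_ideal R" "class_ring" by (rule ideal_relation_ideal)
  show "carrier (presented_algebra R) = range (residue R)"
    by (auto simp: presented_algebra_def Let_def FactRing_def A_RCOSETS_def RCOSETS_def residue_def
        a_r_coset_def)
  show "\<one>\<^bsub>presented_algebra R\<^esub> = residue R 1"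
    by (simp add: presented_algebra_def Let_def FactRing_def residue_def)
  show "\<zero>\<^bsub>presented_algebra R\<^esub> = residue R 0"
    by (auto simp: presented_algebra_def Let_def FactRing_def mem_residue)
  show "residue R p \<oplus>\<^bsub>presented_algebra R\<^esub> residue R r = residue R (p + r)"
    using I.a_rcos_sum[of p r]
    by (simp add: presented_algebra_def Let_def FactRing_def residue_def)
  show "residue R p \<otimes>\<^bsub>presented_algebra R\<^esub> residue R r = residue R (p * r)"
    using I.rcoset_mult_add[of p r]
    by (simp add: presented_algebra_def Let_def FactRing_def residue_def)
  have "c \<odot>\<^bsub>presented_algebra R\<^esub> residue R p = (\<Union>p'\<in>residue R p. residue R (scale c p'))"
    by (simp add: presented_algebra_def Let_def)
  also have "\<dots> = residue R (scale c p)"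
    by (rule UN_residue)
      (simp add: residue_eq_iff mem_residue scale_diff[symmetric] scale_ideal)
  finally show "c \<odot>\<^bsub>presented_algebra R\<^esub> residue R p = residue R (scale c p)" .
qed

lemma presented_algebra_pow:
  "residue R p [^]\<^bsub>presented_algebra R\<^esub> (n::nat) = residue R (p ^ n)"
proof -
  have pow0: "x [^]\<^bsub>presented_algebra R\<^esub> (0::nat) = residue R 1" for x
    by (simp add: nat_pow_def presented_algebra_simps)
  have powS: "x [^]\<^bsub>presented_algebra R\<^esub> Suc n = x [^]\<^bsub>presented_algebra R\<^esub> n \<otimes>\<^bsub>presented_algebra R\<^esub> x" for x n
    by (simp add: nat_pow_def)
  show ?thesis
    by (induction n) (simp_all only: pow0 powS presented_algebra_simps power_0 power_Suc2)
qed

lemma single_Word_Cons: "Poly_Mapping.single (Word (g # w)) c = gen g * Poly_Mapping.single (Word w) c"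
  by (simp add: gen_def mult_single plus_word_def)

text \<open>The classes of the generators generate the algebra; a statement about all elements of
  \<^const>\<open>Uq\<close> thus only has to be checked on \<open>k\<close>, \<open>k\<inverse>\<close>, \<open>e\<close> and \<open>f\<close>.\<close>

lemma presented_algebra_induct [consumes 1, case_names one gen add smult mult]:
  assumes h: "h \<in> carrier (presented_algebra R)"
    and one: "P \<one>\<^bsub>presented_algebra R\<^esub>"
    and gen: "\<And>g. P (residue R (gen g))"
    and add: "\<And>h h'. \<lbrakk>h \<in> carrier (presented_algebra R); h' \<in> carrier (presented_algebra R); P h; P h'\<rbrakk>
        \<Longrightarrow> P (h \<oplus>\<^bsub>presented_algebra R\<^esub> h')"
    and smult: "\<And>c h. \<lbrakk>h \<in> carrier (presented_algebra R); P h\<rbrakk> \<Longrightarrow> P (c \<odot>\<^bsub>presented_algebra R\<^esub> h)"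
    and mult: "\<And>h h'. \<lbrakk>h \<in> carrier (presented_algebra R); h' \<in> carrier (presented_algebra R); P h; P h'\<rbrakk>
        \<Longrightarrow> P (h \<otimes>\<^bsub>presented_algebra R\<^esub> h')"
  shows "P h"
proof -
  have car: "residue R p \<in> carrier (presented_algebra R)" for p
    by (simp add: presented_algebra_simps)
  have word: "P (residue R (Poly_Mapping.single (Word w) 1))" for w
  proof (induction w)
    case Nil
    show ?case using one by (simp add: presented_algebra_simps zero_word_def[symmetric])
  next
    case (Cons g w)
    show ?case using mult[OF car car gen Cons.IH] by (simp add: presented_algebra_simps single_Word_Cons)
  qed
  have sing: "P (residue R (Poly_Mapping.single w c))" for w c
    using smult[OF car word, of c "letters w"] by (simp add: presented_algebra_simps)
  have "P (residue R p)" for p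
  proof (induction p rule: poly_mapping_induct)
    case zero
    show ?case using sing[of 0 0] by simp
  next
    case (add w c u)
    show ?case using assms(4)[OF car car sing add.IH] by (simp add: presented_algebra_simps)
  qed
  then show ?thesis using h by (auto simp: presented_algebra_simps)
qed

lemma residue_cong:
  "\<lbrakk>residue R a = residue R a'; residue R b = residue R b'\<rbrakk> \<Longrightarrow> residue R (a + b) = residue R (a' + b')"
  "\<lbrakk>residue R a = residue R a'; residue R b = residue R b'\<rbrakk> \<Longrightarrow> residue R (a * b) = residue R (a' * b')"
  "residue R a = residue R a' \<Longrightarrow> residue R (scale c a) = residue R (scale c a')"
  by (metis presented_algebra_simps(4)) (metis presented_algebra_simps(5), metis presented_algebra_simps(6))

text \<open>Operators that satisfy the relators satisfy all their consequences: the elements that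
  act by zero form a two-sided ideal.\<close>

lemma free_operator_relation_ideal:
  assumes "\<And>r v. r \<in> R \<Longrightarrow> free_operator (\<lambda>g. lin (b g)) r v = 0" and p: "p \<in> relation_ideal R"
  shows "free_operator (\<lambda>g. lin (b g)) p v = 0"
proof -
  let ?K = "{p. \<forall>v. free_operator (\<lambda>g. lin (b g)) p v = 0}"
  have "ideal ?K class_ring"
  proof (rule idealI[OF class_ring.ring_axioms])
    show "subgroup ?K (add_monoid class_ring)"
    proof (rule subgroup.intro)
      fix a assume a: "a \<in> ?K"
      have "\<ominus>\<^bsub>class_ring\<^esub> a = - a" by (simp add: class_ring_simps)
      then have "inv\<^bsub>add_monoid class_ring\<^esub> a = - a" unfolding a_inv_def .
      then show "inv\<^bsub>add_monoid class_ring\<^esub> a \<in> ?K"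
        using a by (simp add: free_operator_uminus)
    qed (simp_all add: free_operator_simps)
  qed (use free_operator_lin(2)[where c=0] in \<open>simp_all add: free_operator_mult\<close>)
  then have "relation_ideal R \<subseteq> ?K"
    by (rule relation_ideal_minimal) (use assms(1) in auto)
  then show ?thesis using p by auto
qed

lemma presented_algebra_vectorspace: "vectorspace class_ring (presented_algebra R)"
proof (rule vectorspace.intro)
  show "Module.module class_ring (presented_algebra R)"
  proof (rule module_criteria)
    show "cring (class_ring :: complex ring)" by (rule class_cring.cring_axioms)
    show "\<forall>v\<in>carrier (presented_algebra R). \<exists>v'\<in>carrier (presented_algebra R).
        v \<oplus>\<^bsub>presented_algebra R\<^esub> v' = \<zero>\<^bsub>presented_algebra R\<^esub>"
      by (auto simp: presented_algebra_simps intro: exI[of _ "- _"])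
         (metis add.right_inverse presented_algebra_simps(4))
  qed (auto simp: presented_algebra_simps scale_add scale_add_left add.commute add.left_commute)
  show "field (class_ring :: complex ring)" by (rule class_field)
qed

text \<open>A span of images of basis vectors is the set of images of all vectors supported on these
  basis vectors. This turns the spans in the definitions of the submodules into support conditions.\<close>

lemma span_linear_image:
  assumes N: "Module.module class_ring N" and car: "range f \<subseteq> carrier N"
    and add: "\<And>u v. f (u + v) = f u \<oplus>\<^bsub>N\<^esub> f v" and sc: "\<And>c u. f (scale c u) = c \<odot>\<^bsub>N\<^esub> f u"
  shows "LinearCombinations.module.span class_ring N ((\<lambda>i. f (Poly_Mapping.single i 1)) ` S)
    = f ` {c. Poly_Mapping.keys c \<subseteq> S}" (is "?span = ?im")
proof -
  interpret N: Module.module class_ring N by fact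
  have f_zero: "f 0 = \<zero>\<^bsub>N\<^esub>"
    using sc[of 0 0] car N.lmult_0[of "f 0"] by (simp add: image_subset_iff)
  have sub: "(\<lambda>i. f (Poly_Mapping.single i 1)) ` S \<subseteq> carrier N" using car by auto
  have im: "submodule class_ring ?im N"
  proof
    show "?im \<subseteq> carrier N" using car by auto
    show "v \<oplus>\<^bsub>N\<^esub> w \<in> ?im" if "v \<in> ?im" "w \<in> ?im" for v w
      using that keys_add by (fastforce simp: add[symmetric])
    show "\<zero>\<^bsub>N\<^esub> \<in> ?im" unfolding f_zero[symmetric] by (rule imageI) simp
    show "c \<odot>\<^bsub>N\<^esub> v \<in> ?im" if "v \<in> ?im" for c v
      using that by (force simp: sc[symmetric] in_keys_iff)
  qed
  interpret sp: submodule class_ring ?span N by (rule N.span_is_submodule[OF sub])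
  show ?thesis
  proof
    show "?span \<subseteq> ?im"
      by (rule N.span_is_subset[OF _ im]) auto
    have "f c \<in> ?span" if "Poly_Mapping.keys c \<subseteq> S" for c
      using that
    proof (induction c rule: poly_mapping_induct)
      case zero
      show ?case unfolding f_zero by (rule sp.zero_closed)
    next
      case (add i a c)
      have "Poly_Mapping.lookup (Poly_Mapping.single i a + c) i \<noteq> 0"
        using add.hyps by (simp add: lookup_add in_keys_iff)
      then have "i \<in> S" using add.prems by (auto simp: in_keys_iff)
      moreover have "Poly_Mapping.keys c \<subseteq> S"
      proof
        fix j assume "j \<in> Poly_Mapping.keys c"
        then have "Poly_Mapping.lookup (Poly_Mapping.single i a + c) j \<noteq> 0"
          using add.hyps by (auto simp: lookup_add in_keys_iff lookup_single when_def)
        then show "j \<in> S" using add.prems by (auto simp: in_keys_iff)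
      qed
      moreover have "f (Poly_Mapping.single i a + c) = a \<odot>\<^bsub>N\<^esub> f (Poly_Mapping.single i 1) \<oplus>\<^bsub>N\<^esub> f c"
        by (simp add: assms(3) sc[symmetric])
      ultimately show ?case
        using add.IH N.in_own_span[OF sub] by (auto intro!: sp.m_closed sp.smult_closed)
    qed
    then show "?im \<subseteq> ?span" by auto
  qed
qed

section \<open>The monomial basis of the quantum plane\<close>

text \<open>Left multiplication by the generators in the expected basis \<open>x\<^sup>m y\<^sup>p\<close>, where moving \<open>y\<close> past
  \<open>x\<^sup>m\<close> costs the factor \<open>q\<^sup>m\<close>. These operators make the formal combinations of monomials a
  representation of the quantum plane.\<close>

fun qp_mult :: "complex \<Rightarrow> qp_gen \<Rightarrow> nat \<times> nat \<Rightarrow> (nat \<times> nat \<Rightarrow>\<^sub>0 complex)" where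
  "qp_mult q gx (m, p) = Poly_Mapping.single (Suc m, p) 1"
| "qp_mult q gy (m, p) = Poly_Mapping.single (m, Suc p) (q ^ m)"

definition qp_nf :: "complex \<Rightarrow> qp_gen free_alg \<Rightarrow> (nat \<times> nat \<Rightarrow>\<^sub>0 complex)" where
  "qp_nf q r = free_operator (\<lambda>g. lin (qp_mult q g)) r (Poly_Mapping.single (0, 0) 1)"

definition qp_monomial :: "nat \<times> nat \<Rightarrow> qp_gen free_alg" where
  "qp_monomial i = gen gx ^ fst i * gen gy ^ snd i"

definition qp_elem :: "complex \<Rightarrow> (nat \<times> nat \<Rightarrow>\<^sub>0 complex) \<Rightarrow> qp_gen free_alg set" where
  "qp_elem q c = residue (qp_relators q) (lin qp_monomial c)"

lemma qp_relator_zero: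
  assumes "r \<in> qp_relators q"
  shows "free_operator (\<lambda>g. lin (qp_mult q g)) r v = 0"
proof -
  have "lin (qp_mult q gy) (lin (qp_mult q gx) v) = scale q (lin (qp_mult q gx) (lin (qp_mult q gy) v))"
    by (induction v rule: poly_mapping_induct) (auto simp: lin_add lin_scale scale_add ac_simps)
  then show ?thesis
    using assms by (simp add: qp_relators_def free_operator_simps free_operator_mult)
qed

text \<open>The normal form descends to the quantum plane, because the operators respect its relation.\<close>

lemma qp_nf_residue:
  assumes "residue (qp_relators q) r = residue (qp_relators q) r'"
  shows "qp_nf q r = qp_nf q r'"
proof -
  have "free_operator (\<lambda>g. lin (qp_mult q g)) (r - r') (Poly_Mapping.single (0, 0) 1) = 0"
    using assms unfolding residue_eq_iff
    by (rule free_operator_relation_ideal[OF qp_relator_zero, rotated -1])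
  then show ?thesis by (simp add: qp_nf_def free_operator_simps)
qed

lemma qp_nf_monomial: "qp_nf q (qp_monomial (m, p)) = Poly_Mapping.single (m, p) 1"
proof -
  let ?F = "free_operator (\<lambda>g. lin (qp_mult q g))"
  have y: "?F (gen gy ^ p) (Poly_Mapping.single (0, 0) 1) = Poly_Mapping.single (0, p) 1"
    by (induction p) (simp_all add: free_operator_simps free_operator_mult)
  have "?F (gen gx ^ m) (Poly_Mapping.single (0, p) 1) = Poly_Mapping.single (m, p) 1"
    by (induction m) (simp_all add: free_operator_simps free_operator_mult)
  then show ?thesis by (simp add: qp_nf_def qp_monomial_def free_operator_mult y)
qed

lemma qp_nf_lin_monomial: "qp_nf q (lin qp_monomial c) = c"
proof -
  have "qp_nf q (lin qp_monomial c) = lin (\<lambda>i. qp_nf q (qp_monomial i)) c"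
    by (rule lin_compose) (simp_all add: qp_nf_def free_operator_simps)
  also have "(\<lambda>i. qp_nf q (qp_monomial i)) = (\<lambda>i. Poly_Mapping.single i 1)"
    using qp_nf_monomial by auto
  finally show ?thesis by simp
qed

text \<open>Linear independence of the monomials: the normal form recovers the coefficients.\<close>

lemma inj_qp_elem: "inj (qp_elem q)"
  by (rule injI) (metis qp_elem_def qp_nf_lin_monomial qp_nf_residue)

lemma qp_commute: "residue (qp_relators q) (gen gy * gen gx ^ m) = residue (qp_relators q) (scale (q ^ m) (gen gx ^ m * gen gy))"
proof (induction m)
  case 0
  show ?case by simp
next
  case (Suc m)
  let ?r = "residue (qp_relators q)"
  have "?r (gen gy * gen gx) = ?r (scale q (gen gx * gen gy))"
    unfolding residue_eq_iff by (rule relators_in_ideal) (simp add: qp_relators_def)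
  then have "?r ((gen gy * gen gx) * gen gx ^ m) = ?r (scale q (gen gx * gen gy) * gen gx ^ m)"
    by (rule residue_cong) simp
  also have "\<dots> = ?r (scale q (gen gx * (gen gy * gen gx ^ m)))"
    by (simp add: scale_mult mult.assoc)
  also have "\<dots> = ?r (scale q (gen gx * scale (q ^ m) (gen gx ^ m * gen gy)))"
    by (intro residue_cong Suc refl)
  finally show ?case
    by (simp add: scale_commute_mult mult.assoc)
qed

lemma qp_elem_add: "qp_elem q (c + d) = qp_elem q c \<oplus>\<^bsub>qplane q\<^esub> qp_elem q d"
  and qp_elem_scale: "qp_elem q (scale a c) = a \<odot>\<^bsub>qplane q\<^esub> qp_elem q c"
  and qp_elem_zero: "qp_elem q 0 = \<zero>\<^bsub>qplane q\<^esub>"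
  by (simp_all add: qp_elem_def qplane_def presented_algebra_simps lin_add lin_scale)

text \<open>The span of the monomials is a left ideal; since it contains the unit, it is
  everything (\<open>carrier_qplane\<close>).\<close>

lemma qp_gen_mult_elem:
  "residue (qp_relators q) (gen g) \<otimes>\<^bsub>qplane q\<^esub> qp_elem q c = qp_elem q (lin (qp_mult q g) c)"
proof -
  let ?r = "residue (qp_relators q)"
  have "?r (gen g * lin qp_monomial c) = ?r (lin qp_monomial (lin (qp_mult q g) c))"
  proof (induction c rule: poly_mapping_induct)
    case zero
    show ?case by simp
  next
    case (add i a c)
    obtain m p where i: "i = (m, p)" by force
    have "?r (gen g * qp_monomial i) = ?r (lin qp_monomial (qp_mult q g i))"
    proof (cases g)
      case gx
      then show ?thesis by (simp add: i qp_monomial_def mult.assoc)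
    next
      case gy
      have "?r (gen gy * gen gx ^ m * gen gy ^ p) = ?r (scale (q ^ m) (gen gx ^ m * gen gy) * gen gy ^ p)"
        by (intro residue_cong qp_commute refl)
      then show ?thesis using gy by (simp add: i qp_monomial_def mult.assoc scale_mult)
    qed
    then have "?r (scale a (gen g * qp_monomial i)) = ?r (scale a (lin qp_monomial (qp_mult q g i)))"
      by (rule residue_cong)
    then have "?r (scale a (gen g * qp_monomial i) + gen g * lin qp_monomial c)
        = ?r (scale a (lin qp_monomial (qp_mult q g i)) + lin qp_monomial (lin (qp_mult q g) c))"
      by (rule residue_cong) (rule add.IH)
    then show ?case
      by (simp add: lin_add lin_scale distrib_left scale_commute_mult)
  qed
  then show ?thesis by (simp add: qp_elem_def qplane_def presented_algebra_simps)
qed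

text \<open>Together with \<open>inj_qp_elem\<close>: the monomials \<open>x\<^sup>m y\<^sup>p\<close> form a basis of the quantum plane.\<close>

lemma carrier_qplane: "carrier (qplane q) = range (qp_elem q)"
proof -
  let ?r = "residue (qp_relators q)"
  have "h \<in> range (qp_elem q)" if h: "h \<in> carrier (qplane q)" for h
  proof -
    have "h \<otimes>\<^bsub>qplane q\<^esub> qp_elem q c \<in> range (qp_elem q)" for c
      using h[unfolded qplane_def]
    proof (induction h arbitrary: c rule: presented_algebra_induct)
      case one
      show ?case by (simp add: qp_elem_def presented_algebra_simps qplane_def)
    next
      case (gen g)
      show ?case by (simp add: qp_gen_mult_elem)
    next
      case (add h h')
      then obtain a b where "h = ?r a" "h' = ?r b" by (auto simp: presented_algebra_simps)
      moreover from add.IH[of c] obtain d d' where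
        "h \<otimes>\<^bsub>qplane q\<^esub> qp_elem q c = qp_elem q d" "h' \<otimes>\<^bsub>qplane q\<^esub> qp_elem q c = qp_elem q d'"
        by blast
      ultimately have "(h \<oplus>\<^bsub>presented_algebra (qp_relators q)\<^esub> h') \<otimes>\<^bsub>qplane q\<^esub> qp_elem q c = qp_elem q (d + d')"
        unfolding qp_elem_add by (simp add: qp_elem_def qplane_def presented_algebra_simps distrib_right)
          (metis presented_algebra_simps(4))
      then show ?case by simp
    next
      case (smult a h)
      then obtain b where "h = ?r b" by (auto simp: presented_algebra_simps)
      moreover from smult.IH[of c] obtain d where "h \<otimes>\<^bsub>qplane q\<^esub> qp_elem q c = qp_elem q d" by blast
      ultimately have "(a \<odot>\<^bsub>presented_algebra (qp_relators q)\<^esub> h) \<otimes>\<^bsub>qplane q\<^esub> qp_elem q c = qp_elem q (scale a d)"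
        unfolding qp_elem_scale by (simp add: qp_elem_def qplane_def presented_algebra_simps scale_mult)
          (metis presented_algebra_simps(6))
      then show ?case by simp
    next
      case (mult h h')
      then obtain a b where ab: "h = ?r a" "h' = ?r b" by (auto simp: presented_algebra_simps)
      have "(h \<otimes>\<^bsub>presented_algebra (qp_relators q)\<^esub> h') \<otimes>\<^bsub>qplane q\<^esub> qp_elem q c = h \<otimes>\<^bsub>qplane q\<^esub> (h' \<otimes>\<^bsub>qplane q\<^esub> qp_elem q c)"
        by (simp add: ab qp_elem_def qplane_def presented_algebra_simps mult.assoc)
      moreover from mult.IH(2)[of c] obtain d where "h' \<otimes>\<^bsub>qplane q\<^esub> qp_elem q c = qp_elem q d" by blast
      ultimately show ?case using mult.IH(1)[of d] by simp
    qed
    from this[of "Poly_Mapping.single (0, 0) 1"] show ?thesis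
      using h by (auto simp: qp_elem_def qp_monomial_def qplane_def presented_algebra_simps)
  qed
  moreover have "range (qp_elem q) \<subseteq> carrier (qplane q)"
    by (auto simp: qp_elem_def qplane_def presented_algebra_simps)
  ultimately show ?thesis by blast
qed

section \<open>Modules over \<open>U\<^sub>q(sl\<^sub>2)\<close>\<close>

lemma Uq_carrier: "carrier (Uq q) = range (uq_class q)"
  by (auto simp: Uq_def uq_class_def presented_algebra_simps)

lemma uq_class_in_Uq [simp]: "uq_class q p \<in> carrier (Uq q)"
  by (simp add: Uq_carrier)

lemma Uq_simps:
  "\<one>\<^bsub>Uq q\<^esub> = uq_class q 1"
  "uq_class q p \<oplus>\<^bsub>Uq q\<^esub> uq_class q r = uq_class q (p + r)"
  "uq_class q p \<otimes>\<^bsub>Uq q\<^esub> uq_class q r = uq_class q (p * r)"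
  "c \<odot>\<^bsub>Uq q\<^esub> uq_class q p = uq_class q (scale c p)"
  by (simp_all add: Uq_def uq_class_def presented_algebra_simps)

lemmas Uq_induct [consumes 1, case_names one gen add smult mult] =
  presented_algebra_induct[where R = "uq_relators q" for q, folded Uq_def uq_class_def]

lemma uq_class_mem: "p \<in> uq_class q p0 \<Longrightarrow> uq_class q p = uq_class q p0"
  unfolding uq_class_def by (rule residue_eqI)

context uq_module
begin

lemma act_closed [simp]: "\<lbrakk>h \<in> carrier (Uq q); v \<in> carrier M\<rbrakk> \<Longrightarrow> act M h v \<in> carrier M"
  using LinearCombinations.module_hom_closed[OF act_linear] by blast

lemma act_vector_add:
  "\<lbrakk>h \<in> carrier (Uq q); v \<in> carrier M; w \<in> carrier M\<rbrakk> \<Longrightarrow> act M h (v \<oplus> w) = act M h v \<oplus> act M h w"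
  by (rule LinearCombinations.module_hom_add[OF act_linear])

lemma act_vector_smult:
  "\<lbrakk>h \<in> carrier (Uq q); v \<in> carrier M\<rbrakk> \<Longrightarrow> act M h (c \<odot> v) = c \<odot> act M h v"
  using LinearCombinations.module_hom_smult[OF act_linear, of h c v] by simp

lemma smult_in_carrier [simp]: "v \<in> carrier M \<Longrightarrow> c \<odot> v \<in> carrier M"
  using smult_closed[of c v] by simp

lemma zero_smult: "v \<in> carrier M \<Longrightarrow> 0 \<odot> v = \<zero>"
  using lmult_0[of v] by simp

lemma submodule_closed_under_generators:
  assumes W: "submodule class_ring W M"
    and gen: "\<And>g w. w \<in> W \<Longrightarrow> act M (uq_class q (gen g)) w \<in> W"
  shows "uq_submodule q W M"
proof -
  interpret W: submodule class_ring W M by fact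
  have "\<forall>w\<in>W. act M h w \<in> W" if "h \<in> carrier (Uq q)" for h
    using that
  proof (induction h rule: Uq_induct)
    case one
    show ?case using W.subset by (auto simp: act_one)
  next
    case (gen g)
    show ?case using assms(2) by blast
  next
    case (add h h')
    then show ?case using W.subset by (auto simp: act_add)
  next
    case (smult c h)
    then show ?case using W.subset by (auto simp: act_smult)
  next
    case (mult h h')
    then show ?case using W.subset by (auto simp: act_mult)
  qed
  then show ?thesis using W by (simp add: uq_submodule_def)
qed

lemma submodule_uq_module:
  assumes "uq_submodule q W M"
  shows "uq_module q (M\<lparr>carrier := W\<rparr>)"
proof -
  interpret W: submodule class_ring W M using assms by (simp add: uq_submodule_def)
  have act: "act M h w \<in> W" if "h \<in> carrier (Uq q)" "w \<in> W" for h w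
    using assms that by (simp add: uq_submodule_def)
  show ?thesis
  proof (rule uq_module.intro)
    show "vectorspace class_ring (M\<lparr>carrier := W\<rparr>)"
      by (rule vectorspace.intro[OF submodule_is_module[OF W.submodule_axioms] class_field])
    show "uq_module_axioms q (M\<lparr>carrier := W\<rparr>)"
    proof (rule uq_module_axioms.intro)
      show "act (M\<lparr>carrier := W\<rparr>) h \<in> module_hom class_ring (M\<lparr>carrier := W\<rparr>) (M\<lparr>carrier := W\<rparr>)"
        if "h \<in> carrier (Uq q)" for h
        using that act W.subset by (auto simp: LinearCombinations.module_hom_def act_vector_add act_vector_smult subset_iff)
    qed (use W.subset in \<open>auto simp: act_add act_smult act_mult act_one\<close>)
  qed
qed

text \<open>The image of a module under a surjection that respects all operations is a module, as every
  axiom is an equation, a closure property or the existence of a negative. Quotients and the modules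
  given on a basis are recognized as modules in this way.\<close>

lemma image_uq_module:
  fixes N (structure)
  assumes surj: "\<phi> ` carrier M = carrier N"
    and add: "\<And>v w. \<lbrakk>v \<in> carrier M; w \<in> carrier M\<rbrakk> \<Longrightarrow> \<phi> (v \<oplus>\<^bsub>M\<^esub> w) = \<phi> v \<oplus>\<^bsub>N\<^esub> \<phi> w"
    and smult: "\<And>c v. v \<in> carrier M \<Longrightarrow> \<phi> (c \<odot>\<^bsub>M\<^esub> v) = c \<odot>\<^bsub>N\<^esub> \<phi> v"
    and zero: "\<phi> \<zero>\<^bsub>M\<^esub> = \<zero>\<^bsub>N\<^esub>"
    and act: "\<And>h v. \<lbrakk>h \<in> carrier (Uq q); v \<in> carrier M\<rbrakk> \<Longrightarrow> \<phi> (act M h v) = act N h (\<phi> v)"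
  shows "uq_module q N"
proof -
  have all: "(\<forall>v\<in>carrier N. P v) \<longleftrightarrow> (\<forall>v\<in>carrier M. P (\<phi> v))" for P
    unfolding surj[symmetric] by simp
  have car: "\<phi> v \<in> carrier N" if "v \<in> carrier M" for v using that surj by blast
  have neg: "\<exists>w\<in>carrier N. \<phi> v \<oplus>\<^bsub>N\<^esub> w = \<zero>\<^bsub>N\<^esub>" if "v \<in> carrier M" for v
    using that add[of v "\<ominus>\<^bsub>M\<^esub> v"] by (intro bexI[of _ "\<phi> (\<ominus>\<^bsub>M\<^esub> v)"]) (auto simp: r_neg zero car)
  have "Module.module class_ring N"
  proof (rule module_criteria)
    show "cring (class_ring :: complex ring)" by (rule class_cring.cring_axioms)
    show "\<zero>\<^bsub>N\<^esub> \<in> carrier N" unfolding zero[symmetric] by (rule car) simp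
    show "\<forall>v w. v \<in> carrier N \<and> w \<in> carrier N \<longrightarrow> v \<oplus>\<^bsub>N\<^esub> w \<in> carrier N"
      by (auto simp: surj[symmetric] add[symmetric])
    show "\<forall>v\<in>carrier N. \<exists>neg_v\<in>carrier N. v \<oplus>\<^bsub>N\<^esub> neg_v = \<zero>\<^bsub>N\<^esub>"
      using neg by (simp add: all)
    show "\<forall>c v. c \<in> carrier class_ring \<and> v \<in> carrier N \<longrightarrow> c \<odot>\<^bsub>N\<^esub> v \<in> carrier N"
      by (auto simp: surj[symmetric] smult[symmetric])
    show "\<forall>v w. v \<in> carrier N \<and> w \<in> carrier N \<longrightarrow> v \<oplus>\<^bsub>N\<^esub> w = w \<oplus>\<^bsub>N\<^esub> v"
      by (auto simp: surj[symmetric] add[symmetric] a_comm)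
    show "\<forall>v w x. v \<in> carrier N \<and> w \<in> carrier N \<and> x \<in> carrier N \<longrightarrow>
        v \<oplus>\<^bsub>N\<^esub> w \<oplus>\<^bsub>N\<^esub> x = v \<oplus>\<^bsub>N\<^esub> (w \<oplus>\<^bsub>N\<^esub> x)"
      by (auto simp: surj[symmetric] add[symmetric] a_assoc)
    show "\<forall>v\<in>carrier N. v \<oplus>\<^bsub>N\<^esub> \<zero>\<^bsub>N\<^esub> = v"
      by (auto simp: surj[symmetric] add[symmetric] zero[symmetric])
    show "\<forall>a b v. a \<in> carrier class_ring \<and> b \<in> carrier class_ring \<and> v \<in> carrier N \<longrightarrow>
        (a \<otimes>\<^bsub>class_ring\<^esub> b) \<odot>\<^bsub>N\<^esub> v = a \<odot>\<^bsub>N\<^esub> (b \<odot>\<^bsub>N\<^esub> v)"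
      using smult_assoc1 by (auto simp: surj[symmetric] smult[symmetric])
    show "\<forall>v\<in>carrier N. \<one>\<^bsub>class_ring\<^esub> \<odot>\<^bsub>N\<^esub> v = v"
      using smult_one by (auto simp: surj[symmetric] smult[symmetric])
    show "\<forall>a b v. a \<in> carrier class_ring \<and> b \<in> carrier class_ring \<and> v \<in> carrier N \<longrightarrow>
        (a \<oplus>\<^bsub>class_ring\<^esub> b) \<odot>\<^bsub>N\<^esub> v = a \<odot>\<^bsub>N\<^esub> v \<oplus>\<^bsub>N\<^esub> b \<odot>\<^bsub>N\<^esub> v"
      using smult_l_distr by (auto simp: surj[symmetric] smult[symmetric] add[symmetric])
    show "\<forall>a v w. a \<in> carrier class_ring \<and> v \<in> carrier N \<and> w \<in> carrier N \<longrightarrow>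
        a \<odot>\<^bsub>N\<^esub> (v \<oplus>\<^bsub>N\<^esub> w) = a \<odot>\<^bsub>N\<^esub> v \<oplus>\<^bsub>N\<^esub> a \<odot>\<^bsub>N\<^esub> w"
      using smult_r_distr by (auto simp: surj[symmetric] smult[symmetric] add[symmetric])
  qed
  moreover have "uq_module_axioms q N"
  proof (rule uq_module_axioms.intro)
    show "act N h \<in> module_hom class_ring N N" if h: "h \<in> carrier (Uq q)" for h
      using h by (auto simp: LinearCombinations.module_hom_def surj[symmetric] act[symmetric] add[symmetric]
          smult[symmetric] act_vector_add act_vector_smult)
  next
    fix g h v assume "g \<in> carrier (Uq q)" "h \<in> carrier (Uq q)" "v \<in> carrier N"
    moreover have "g \<oplus>\<^bsub>Uq q\<^esub> h \<in> carrier (Uq q)" "g \<otimes>\<^bsub>Uq q\<^esub> h \<in> carrier (Uq q)"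
      using \<open>g \<in> carrier (Uq q)\<close> \<open>h \<in> carrier (Uq q)\<close> by (auto simp: Uq_carrier Uq_simps)
    ultimately show "act N (g \<oplus>\<^bsub>Uq q\<^esub> h) v = act N g v \<oplus>\<^bsub>N\<^esub> act N h v"
      and "act N (g \<otimes>\<^bsub>Uq q\<^esub> h) v = act N g (act N h v)"
      by (auto simp: surj[symmetric] act[symmetric] add[symmetric] act_add act_mult)
  next
    fix c h v assume h: "h \<in> carrier (Uq q)" and "v \<in> carrier N"
    moreover have "c \<odot>\<^bsub>Uq q\<^esub> h \<in> carrier (Uq q)"
      using h by (auto simp: Uq_carrier Uq_simps)
    ultimately show "act N (c \<odot>\<^bsub>Uq q\<^esub> h) v = c \<odot>\<^bsub>N\<^esub> act N h v"
      by (auto simp: surj[symmetric] act[symmetric] smult[symmetric] act_smult)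
  next
    fix v assume "v \<in> carrier N"
    then show "act N \<one>\<^bsub>Uq q\<^esub> v = v"
      using act_one by (auto simp: surj[symmetric] act[symmetric] Uq_simps)
  qed
  ultimately show ?thesis
    by (intro uq_module.intro vectorspace.intro class_field)
qed

text \<open>A linear map into a coordinate space that intertwines the four generators with operators on
  that space intertwines each element with the corresponding word polynomial in these operators.\<close>

lemma generators_determine_action:
  assumes add: "\<And>v w. \<lbrakk>v \<in> carrier M; w \<in> carrier M\<rbrakk> \<Longrightarrow> \<phi> (v \<oplus> w) = \<phi> v + \<phi> w"
    and smult: "\<And>c v. v \<in> carrier M \<Longrightarrow> \<phi> (c \<odot> v) = scale c (\<phi> v)"
    and gen: "\<And>g v. v \<in> carrier M \<Longrightarrow> \<phi> (act M (uq_class q (gen g)) v) = lin (b g) (\<phi> v)"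
    and v: "v \<in> carrier M"
  shows "\<phi> (act M (uq_class q p) v) = free_operator (\<lambda>g. lin (b g)) p (\<phi> v)"
proof (induction p rule: poly_mapping_induct)
  case zero
  have "act M (uq_class q 0) v = 0 \<odot> act M (uq_class q 0) v"
    using act_smult[of "uq_class q 0" v 0] v by (simp add: Uq_simps)
  then show ?case using smult[of "act M (uq_class q 0) v" 0] v by (simp add: free_operator_simps)
next
  case (add w c p)
  have word: "\<phi> (act M (uq_class q (Poly_Mapping.single (Word ws) 1)) v) = foldr (\<lambda>g. lin (b g)) ws (\<phi> v)" for ws
  proof (induction ws)
    case Nil
    show ?case using act_one[OF v] by (simp add: Uq_simps flip: zero_word_def)
  next
    case (Cons g ws)
    show ?case
      using act_mult[of "uq_class q (gen g)" "uq_class q (Poly_Mapping.single (Word ws) 1)" v] v Cons.IH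
      by (simp add: single_Word_Cons Uq_simps gen)
  qed
  have "\<phi> (act M (uq_class q (Poly_Mapping.single w c)) v) = scale c (foldr (\<lambda>g. lin (b g)) (letters w) (\<phi> v))"
    using act_smult[of "uq_class q (Poly_Mapping.single w 1)" v c] v word[of "letters w"]
    by (simp add: Uq_simps smult)
  then show ?case
    using act_add[of "uq_class q (Poly_Mapping.single w c)" "uq_class q p" v] v add.IH assms(1)
    by (simp add: Uq_simps free_operator_simps)
qed

end

lemma basis_module_simps [simp]:
  "carrier (basis_module S b) = {v. Poly_Mapping.keys v \<subseteq> S}"
  "\<zero>\<^bsub>basis_module S b\<^esub> = 0"
  "v \<oplus>\<^bsub>basis_module S b\<^esub> w = v + w"
  "c \<odot>\<^bsub>basis_module S b\<^esub> v = scale c v"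
  by (simp_all add: basis_module_def)

lemma act_basis_module:
  "act (basis_module S b) h v = the_elem ((\<lambda>p. free_operator (\<lambda>g. lin (b g)) p v) ` h)"
  by (simp add: basis_module_def lin_def[abs_def])

text \<open>The operators of a \<^const>\<open>basis_module\<close> act through cosets of the free algebra, and this is
  well defined only if they satisfy the relations of \<open>U\<^sub>q(sl\<^sub>2)\<close>. If an honest module maps onto the
  space and the map intertwines the generators, then the value on a coset does not depend on the
  representative: it is the image of the action upstairs.\<close>

lemma (in uq_module) basis_module_image:
  assumes add: "\<And>v w. \<lbrakk>v \<in> carrier M; w \<in> carrier M\<rbrakk> \<Longrightarrow> \<phi> (v \<oplus> w) = \<phi> v + \<phi> w"
    and smult: "\<And>c v. v \<in> carrier M \<Longrightarrow> \<phi> (c \<odot> v) = scale c (\<phi> v)"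
    and gen: "\<And>g v. v \<in> carrier M \<Longrightarrow> \<phi> (act M (uq_class q (gen g)) v) = lin (b g) (\<phi> v)"
    and surj: "\<phi> ` carrier M = {v. Poly_Mapping.keys v \<subseteq> S}"
  shows "uq_module q (basis_module S b)"
    and "\<lbrakk>h \<in> carrier (Uq q); v \<in> carrier M\<rbrakk> \<Longrightarrow> \<phi> (act M h v) = act (basis_module S b) h (\<phi> v)"
    and "Poly_Mapping.keys w \<subseteq> S \<Longrightarrow> act (basis_module S b) (uq_class q (gen g)) w = lin (b g) w"
proof -
  show eq: "\<phi> (act M h v) = act (basis_module S b) h (\<phi> v)"
    if h: "h \<in> carrier (Uq q)" and v: "v \<in> carrier M" for h v
  proof -
    obtain p0 where p0: "h = uq_class q p0" using h by (auto simp: Uq_carrier)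
    have "free_operator (\<lambda>g. lin (b g)) p (\<phi> v) = \<phi> (act M h v)" if "p \<in> h" for p
      using generators_determine_action[OF add smult gen v, of p] uq_class_mem[of p q p0] that
      by (simp add: p0)
    moreover have "p0 \<in> h" by (simp add: p0 uq_class_def)
    ultimately have "(\<lambda>p. free_operator (\<lambda>g. lin (b g)) p (\<phi> v)) ` h = {\<phi> (act M h v)}"
      by force
    then show ?thesis by (simp add: act_basis_module)
  qed
  show "uq_module q (basis_module S b)"
  proof (rule image_uq_module[of \<phi>])
    show "\<phi> \<zero> = \<zero>\<^bsub>basis_module S b\<^esub>"
      using smult[of \<zero> 0] zero_smult[of \<zero>] by simp
  qed (simp_all add: surj add smult eq)
  show "act (basis_module S b) (uq_class q (gen g)) w = lin (b g) w" if "Poly_Mapping.keys w \<subseteq> S"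
  proof -
    have "w \<in> \<phi> ` carrier M" using that surj by simp
    then obtain v where "v \<in> carrier M" "w = \<phi> v" by blast
    then show ?thesis using eq[of "uq_class q (gen g)" v] gen by simp
  qed
qed

text \<open>The homomorphism theorem. The coset of \<open>x\<close> is the fibre of \<open>\<phi>\<close> through \<open>x\<close>, so that all
  operations on cosets can be computed in \<open>N\<close>.\<close>

lemma uq_quotient_isomorphic:
  assumes M: "uq_module q M" and N: "uq_module q N"
    and hom: "\<phi> \<in> module_hom class_ring M N" and surj: "\<phi> ` carrier M = carrier N"
    and act: "\<And>h v. \<lbrakk>h \<in> carrier (Uq q); v \<in> carrier M\<rbrakk> \<Longrightarrow> \<phi> (act M h v) = act N h (\<phi> v)"
    and J: "J = {v \<in> carrier M. \<phi> v = \<zero>\<^bsub>N\<^esub>}"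
  shows "uq_isomorphic q (uq_quotient M J) N"
proof -
  interpret M: uq_module q M by fact
  interpret N: uq_module q N by fact
  note add = LinearCombinations.module_hom_add[OF hom]
  have smult: "\<phi> (c \<odot>\<^bsub>M\<^esub> v) = c \<odot>\<^bsub>N\<^esub> \<phi> v" if "v \<in> carrier M" for c v
    using LinearCombinations.module_hom_smult[OF hom _ that, of c] by simp
  have car: "\<phi> v \<in> carrier N" if "v \<in> carrier M" for v using surj that by blast
  have mh: "mod_hom class_ring M N \<phi>"
    by (intro mod_hom.intro mod_hom_axioms.intro hom M.module_axioms N.module_axioms)
  note minus = mod_hom.f_minus[OF mh] and f0 = mod_hom.f0_is_0[OF mh]
  define \<kappa> where "\<kappa> x = {y \<in> carrier M. \<phi> y = \<phi> x}" for x
  have coset: "J +>\<^bsub>M\<^esub> x = \<kappa> x" if x: "x \<in> carrier M" for x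
  proof (intro Set.set_eqI iffI)
    fix y assume "y \<in> J +>\<^bsub>M\<^esub> x"
    then obtain j where "j \<in> J" "y = j \<oplus>\<^bsub>M\<^esub> x" by (auto simp: a_r_coset_def r_coset_def)
    then show "y \<in> \<kappa> x" using x car by (simp add: \<kappa>_def J add)
  next
    fix y assume y: "y \<in> \<kappa> x"
    then have "y \<ominus>\<^bsub>M\<^esub> x \<in> J" using x car
      by (simp add: \<kappa>_def J minus)
    moreover have "y = (y \<ominus>\<^bsub>M\<^esub> x) \<oplus>\<^bsub>M\<^esub> x"
      using x y by (simp add: \<kappa>_def M.minus_eq M.a_assoc M.l_neg)
    ultimately show "y \<in> J +>\<^bsub>M\<^esub> x" by (auto simp: a_r_coset_def r_coset_def)
  qed
  let ?Q = "uq_quotient M J"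
  have Qcar: "carrier ?Q = \<kappa> ` carrier M"
    using coset by (auto simp: uq_quotient_def A_RCOSETS_def RCOSETS_def a_r_coset_def)
  have self: "x \<in> \<kappa> x" if "x \<in> carrier M" for x using that by (simp add: \<kappa>_def)
  have mem: "y \<in> carrier M" "\<phi> y = \<phi> x" if "y \<in> \<kappa> x" for x y using that by (simp_all add: \<kappa>_def)
  have eq: "\<kappa> x = \<kappa> y \<longleftrightarrow> \<phi> x = \<phi> y" if "x \<in> carrier M" "y \<in> carrier M" for x y
    using that by (auto simp: \<kappa>_def)
  have Qzero: "\<kappa> \<zero>\<^bsub>M\<^esub> = \<zero>\<^bsub>?Q\<^esub>" by (simp add: uq_quotient_def \<kappa>_def J f0)
  have Qadd: "\<kappa> (x \<oplus>\<^bsub>M\<^esub> y) = \<kappa> x \<oplus>\<^bsub>?Q\<^esub> \<kappa> y" if x: "x \<in> carrier M" and y: "y \<in> carrier M" for x y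
  proof -
    have "z \<in> (\<Union>h\<in>\<kappa> x. \<Union>k\<in>\<kappa> y. {h \<oplus>\<^bsub>M\<^esub> k})" if z: "z \<in> \<kappa> (x \<oplus>\<^bsub>M\<^esub> y)" for z
    proof -
      have zc: "z \<in> carrier M" using z mem by blast
      have "\<phi> (z \<ominus>\<^bsub>M\<^esub> x) = (\<phi> x \<oplus>\<^bsub>N\<^esub> \<phi> y) \<ominus>\<^bsub>N\<^esub> \<phi> x"
        using mem[OF z] x y zc by (simp add: minus add)
      also have "\<dots> = \<phi> y" using car[OF x] car[OF y] by (simp add: N.minus_eq N.a_comm N.r_neg1)
      finally have "z \<ominus>\<^bsub>M\<^esub> x \<in> \<kappa> y" using zc x by (simp add: \<kappa>_def)
      moreover have "z = x \<oplus>\<^bsub>M\<^esub> (z \<ominus>\<^bsub>M\<^esub> x)"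
        using zc x by (simp add: M.minus_eq M.a_lcomm[of x z] M.r_neg)
      ultimately show ?thesis using self[OF x] by blast
    qed
    moreover have "h \<oplus>\<^bsub>M\<^esub> k \<in> \<kappa> (x \<oplus>\<^bsub>M\<^esub> y)" if "h \<in> \<kappa> x" "k \<in> \<kappa> y" for h k
      using mem[OF that(1)] mem[OF that(2)] x y by (simp add: \<kappa>_def add)
    ultimately have "\<kappa> (x \<oplus>\<^bsub>M\<^esub> y) = (\<Union>h\<in>\<kappa> x. \<Union>k\<in>\<kappa> y. {h \<oplus>\<^bsub>M\<^esub> k})" by blast
    then show ?thesis by (simp add: uq_quotient_def set_add_def set_mult_def)
  qed
  have UN: "(\<Union>y\<in>\<kappa> x. J +>\<^bsub>M\<^esub> F y) = \<kappa> (F x)"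
    if "x \<in> carrier M" "\<And>y. y \<in> carrier M \<Longrightarrow> F y \<in> carrier M" "\<And>y. y \<in> \<kappa> x \<Longrightarrow> \<phi> (F y) = \<phi> (F x)" for F x
  proof -
    have "J +>\<^bsub>M\<^esub> F y = \<kappa> (F x)" if "y \<in> \<kappa> x" for y
      using that coset[of "F y"] eq[of "F y" "F x"] mem(1)[OF that] \<open>x \<in> carrier M\<close>
        \<open>\<And>y. y \<in> carrier M \<Longrightarrow> F y \<in> carrier M\<close> \<open>\<And>y. y \<in> \<kappa> x \<Longrightarrow> \<phi> (F y) = \<phi> (F x)\<close> by simp
    then show ?thesis using self[OF \<open>x \<in> carrier M\<close>] by blast
  qed
  have Qsmult: "\<kappa> (c \<odot>\<^bsub>M\<^esub> x) = c \<odot>\<^bsub>?Q\<^esub> \<kappa> x" if "x \<in> carrier M" for c x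
    using UN[OF that, of "\<lambda>y. c \<odot>\<^bsub>M\<^esub> y"] that mem by (simp add: uq_quotient_def smult)
  have Qact: "\<kappa> (act M h x) = act ?Q h (\<kappa> x)" if h: "h \<in> carrier (Uq q)" and x: "x \<in> carrier M" for h x
    using UN[OF x, of "\<lambda>y. act M h y"] h x mem by (simp add: uq_quotient_def act)
  have Q: "uq_module q ?Q"
    by (rule M.image_uq_module[OF Qcar[symmetric] Qadd Qsmult Qzero Qact])
  define \<Phi> where "\<Phi> X = the_elem (\<phi> ` X)" for X
  have \<Phi>: "\<Phi> (\<kappa> x) = \<phi> x" if "x \<in> carrier M" for x
  proof -
    have "\<phi> ` \<kappa> x = {\<phi> x}" using that by (auto simp: \<kappa>_def)
    then show ?thesis by (simp add: \<Phi>_def)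
  qed
  have "\<Phi> \<in> module_hom class_ring ?Q N"
    by (auto simp: LinearCombinations.module_hom_def Qcar \<Phi> car Qadd[symmetric] Qsmult[symmetric] add smult)
  moreover have "bij_betw \<Phi> (carrier ?Q) (carrier N)"
    by (auto simp: bij_betw_def inj_on_def Qcar \<Phi> eq surj[symmetric] image_image)
  moreover have "\<forall>h\<in>carrier (Uq q). \<forall>v\<in>carrier ?Q. \<Phi> (act ?Q h v) = act N h (\<Phi> v)"
    by (auto simp: Qcar \<Phi> Qact[symmetric] act)
  ultimately show ?thesis using Q N by (auto simp: uq_isomorphic_def)
qed

text \<open>Combines the homomorphism theorem with \<open>basis_module_image\<close>; a map on coordinates is all
  that has to be supplied to identify a module or a quotient with a \<^const>\<open>basis_module\<close>.\<close>

lemma (in uq_module) basis_module_quotient: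
  assumes add: "\<And>v w. \<lbrakk>v \<in> carrier M; w \<in> carrier M\<rbrakk> \<Longrightarrow> \<phi> (v \<oplus> w) = \<phi> v + \<phi> w"
    and smult: "\<And>c v. v \<in> carrier M \<Longrightarrow> \<phi> (c \<odot> v) = scale c (\<phi> v)"
    and gen: "\<And>g v. v \<in> carrier M \<Longrightarrow> \<phi> (act M (uq_class q (gen g)) v) = lin (b g) (\<phi> v)"
    and surj: "\<phi> ` carrier M = {v. Poly_Mapping.keys v \<subseteq> S}"
  shows "uq_isomorphic q (uq_quotient M {v \<in> carrier M. \<phi> v = 0}) (basis_module S b)"
    and "inj_on \<phi> (carrier M) \<Longrightarrow> uq_isomorphic q M (basis_module S b)"
proof -
  note B = basis_module_image[OF add smult gen surj]
  have hom: "\<phi> \<in> module_hom class_ring M (basis_module S b)"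
    using surj by (auto simp: LinearCombinations.module_hom_def add smult)
  show "uq_isomorphic q (uq_quotient M {v \<in> carrier M. \<phi> v = 0}) (basis_module S b)"
    by (rule uq_quotient_isomorphic[OF uq_module_axioms B(1) hom])
      (simp_all add: surj B(2))
  show "uq_isomorphic q M (basis_module S b)" if "inj_on \<phi> (carrier M)"
    unfolding uq_isomorphic_def bij_betw_def
    using uq_module_axioms B(1,2) hom that surj by auto
qed

lemma (in uq_module) uq_submodule_of_submodule:
  assumes V: "uq_submodule q V M" and W: "uq_submodule q W M" and "W \<subseteq> V"
  shows "uq_submodule q W (M\<lparr>carrier := V\<rparr>)"
proof -
  interpret V: uq_module q "M\<lparr>carrier := V\<rparr>" by (rule submodule_uq_module[OF V])
  interpret W: submodule class_ring W M using W by (simp add: uq_submodule_def)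
  have "submodule class_ring W (M\<lparr>carrier := V\<rparr>)"
    using V.module_axioms assms(3) by unfold_locales auto
  then show ?thesis using W by (simp add: uq_submodule_def)
qed

text \<open>Simplicity is proved for the modules given on a basis and transported to their isomorphic
  copies inside the quantum plane.\<close>

lemma uq_simple_isomorphic:
  assumes iso: "uq_isomorphic q M N" and simple: "uq_simple q N"
  shows "uq_simple q M"
proof -
  obtain \<phi> where M: "uq_module q M" and N: "uq_module q N" and hom: "\<phi> \<in> module_hom class_ring M N"
    and bij: "bij_betw \<phi> (carrier M) (carrier N)"
    and act: "\<And>h v. \<lbrakk>h \<in> carrier (Uq q); v \<in> carrier M\<rbrakk> \<Longrightarrow> \<phi> (act M h v) = act N h (\<phi> v)"
    using iso by (auto simp: uq_isomorphic_def)
  interpret M: uq_module q M by fact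
  interpret N: uq_module q N by fact
  note add = LinearCombinations.module_hom_add[OF hom]
  have smult: "\<phi> (c \<odot>\<^bsub>M\<^esub> v) = c \<odot>\<^bsub>N\<^esub> \<phi> v" if "v \<in> carrier M" for c v
    using LinearCombinations.module_hom_smult[OF hom _ that, of c] by simp
  have mh: "mod_hom class_ring M N \<phi>"
    by (intro mod_hom.intro mod_hom_axioms.intro hom M.module_axioms N.module_axioms)
  note f0 = mod_hom.f0_is_0[OF mh]
  have inj: "inj_on \<phi> (carrier M)" and surj: "\<phi> ` carrier M = carrier N"
    using bij by (auto simp: bij_betw_def)
  have "carrier M \<noteq> {\<zero>\<^bsub>M\<^esub>}"
    using simple surj f0 by (auto simp: uq_simple_def)
  moreover have "W = {\<zero>\<^bsub>M\<^esub>} \<or> W = carrier M" if W: "uq_submodule q W M" for W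
  proof -
    interpret W: submodule class_ring W M using W by (simp add: uq_submodule_def)
    have actW: "act M h w \<in> W" if "h \<in> carrier (Uq q)" "w \<in> W" for h w
      using W that by (simp add: uq_submodule_def)
    have "submodule class_ring (\<phi> ` W) N"
    proof
      show "\<phi> ` W \<subseteq> carrier N" using W.subset surj by blast
      show "\<zero>\<^bsub>N\<^esub> \<in> \<phi> ` W" unfolding f0[symmetric] by (rule imageI) simp
      show "v \<oplus>\<^bsub>N\<^esub> w \<in> \<phi> ` W" if "v \<in> \<phi> ` W" "w \<in> \<phi> ` W" for v w
        using that W.subset by (force simp: add[symmetric] subset_iff)
      show "c \<odot>\<^bsub>N\<^esub> v \<in> \<phi> ` W" if "v \<in> \<phi> ` W" for c v
        using that W.subset by (force simp: smult[symmetric] subset_iff)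
    qed
    moreover have "act N h w \<in> \<phi> ` W" if "h \<in> carrier (Uq q)" "w \<in> \<phi> ` W" for h w
      using that W.subset actW by (force simp: act[symmetric] subset_iff)
    ultimately have "uq_submodule q (\<phi> ` W) N" by (simp add: uq_submodule_def)
    then have "\<phi> ` W = {\<zero>\<^bsub>N\<^esub>} \<or> \<phi> ` W = carrier N" using simple by (simp add: uq_simple_def)
    then have "\<phi> ` W = \<phi> ` {\<zero>\<^bsub>M\<^esub>} \<or> \<phi> ` W = \<phi> ` carrier M" using surj f0 by simp
    then show ?thesis
      using inj_on_image_eq_iff[OF inj W.subset, of "{\<zero>\<^bsub>M\<^esub>}"]
        inj_on_image_eq_iff[OF inj W.subset, of "carrier M"] by simp
  qed
  ultimately show ?thesis using M by (simp add: uq_simple_def)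
qed

lemma hom_finsum:
  assumes N: "abelian_monoid N" and f: "f \<in> A \<rightarrow> carrier N"
    and add: "\<And>v w. \<lbrakk>v \<in> carrier N; w \<in> carrier N\<rbrakk> \<Longrightarrow> \<phi> (v \<oplus>\<^bsub>N\<^esub> w) = \<phi> v + \<phi> w" and zero: "\<phi> \<zero>\<^bsub>N\<^esub> = (0::'b::comm_monoid_add)"
  shows "\<phi> (\<Oplus>\<^bsub>N\<^esub>i\<in>A. f i) = (\<Sum>i\<in>A. \<phi> (f i))"
proof -
  interpret abelian_monoid N by fact
  show ?thesis using f
  proof (induction A rule: infinite_finite_induct)
    case (infinite A)
    then show ?case by (simp add: zero finsum_infinite)
  next
    case empty
    show ?case by (simp add: zero)
  next
    case (insert i A)
    then show ?case by (simp add: add finsum_closed)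
  qed
qed

text \<open>A vector space with coordinates in a finite set \<open>S\<close> has the preimages of the unit vectors as
  a basis.\<close>

lemma dim_of_coordinates:
  assumes N: "vectorspace class_ring N"
    and add: "\<And>v w. \<lbrakk>v \<in> carrier N; w \<in> carrier N\<rbrakk> \<Longrightarrow> \<phi> (v \<oplus>\<^bsub>N\<^esub> w) = \<phi> v + \<phi> w"
    and smult: "\<And>c v. v \<in> carrier N \<Longrightarrow> \<phi> (c \<odot>\<^bsub>N\<^esub> v) = scale c (\<phi> v)"
    and bij: "bij_betw \<phi> (carrier N) {v. Poly_Mapping.keys v \<subseteq> S}"
    and fin: "finite S"
  shows "vectorspace.fin_dim class_ring N" "vectorspace.dim class_ring N = card S"
proof -
  interpret N: vectorspace class_ring N by fact
  have inj: "inj_on \<phi> (carrier N)" and surj: "\<phi> ` carrier N = {v. Poly_Mapping.keys v \<subseteq> S}"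
    using bij by (auto simp: bij_betw_def)
  have smult_car: "c \<odot>\<^bsub>N\<^esub> v \<in> carrier N" if "v \<in> carrier N" for c v
    using N.smult_closed[of c v] that by simp
  have \<phi>0: "\<phi> \<zero>\<^bsub>N\<^esub> = 0" using smult[of "\<zero>\<^bsub>N\<^esub>" 0] N.lmult_0[of "\<zero>\<^bsub>N\<^esub>"] by simp
  \<comment> \<open>The projection to the coordinates in \<open>S\<close> makes the inverse of \<open>\<phi>\<close> a map on the whole
    coordinate space, as \<open>span_linear_image\<close> asks for.\<close>
  define r where "r = lin (\<lambda>i. if i \<in> S then Poly_Mapping.single i (1::complex) else 0)"
  have r_lookup: "Poly_Mapping.lookup (r c) i = (if i \<in> S then Poly_Mapping.lookup c i else 0)" for c i
    by (induction c rule: poly_mapping_induct)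
      (auto simp: r_def lin_add lookup_add lookup_single when_def)
  have r_keys: "Poly_Mapping.keys (r c) \<subseteq> S" for c
    by (auto simp: in_keys_iff r_lookup split: if_splits)
  have r_id: "r c = c" if "Poly_Mapping.keys c \<subseteq> S" for c
    using that by (intro poly_mapping_eqI) (auto simp: r_lookup in_keys_iff)
  define f where "f c = inv_into (carrier N) \<phi> (r c)" for c
  have f_car: "f c \<in> carrier N" and f: "\<phi> (f c) = r c" for c
    using r_keys surj unfolding f_def by (auto intro!: inv_into_into f_inv_into_f)
  let ?B = "(\<lambda>i. f (Poly_Mapping.single i 1)) ` S"
  have "N.span ?B = f ` {c. Poly_Mapping.keys c \<subseteq> S}"
  proof (rule span_linear_image[OF N.module_axioms])
    show "f (u + v) = f u \<oplus>\<^bsub>N\<^esub> f v" for u v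
      by (rule inj_onD[OF inj]) (simp_all add: f add f_car, simp add: r_def lin_add)
    show "f (scale c u) = c \<odot>\<^bsub>N\<^esub> f u" for c u
      by (rule inj_onD[OF inj]) (simp_all add: f smult f_car smult_car, simp add: r_def lin_scale)
  qed (use f_car in auto)
  also have "\<dots> = carrier N"
  proof
    show "carrier N \<subseteq> f ` {c. Poly_Mapping.keys c \<subseteq> S}"
    proof
      fix v assume v: "v \<in> carrier N"
      then have k: "Poly_Mapping.keys (\<phi> v) \<subseteq> S" using surj by blast
      have "f (\<phi> v) = v" by (rule inj_onD[OF inj]) (simp_all add: f f_car v r_id[OF k])
      then show "v \<in> f ` {c. Poly_Mapping.keys c \<subseteq> S}" using k by force
    qed
  qed (use f_car in auto)
  finally have gen: "N.gen_set ?B" .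
  have B: "?B \<subseteq> carrier N" using f_car by auto
  have fS: "\<phi> (f (Poly_Mapping.single i 1)) = Poly_Mapping.single i 1" if "i \<in> S" for i
    using that by (simp add: f r_id)
  have inj_f: "inj_on (\<lambda>i. f (Poly_Mapping.single i 1)) S"
  proof (rule inj_onI)
    fix i j assume "i \<in> S" "j \<in> S" "f (Poly_Mapping.single i 1) = f (Poly_Mapping.single j 1)"
    then have "Poly_Mapping.lookup (Poly_Mapping.single i 1) i = Poly_Mapping.lookup (Poly_Mapping.single j (1::complex)) i"
      using fS by metis
    then show "i = j" by (simp add: lookup_single when_def split: if_splits)
  qed
  have "N.lin_indpt ?B"
  proof (rule N.finite_lin_indpt2[OF finite_imageI[OF fin] B])
    fix a assume a: "N.lincomb a ?B = \<zero>\<^bsub>N\<^esub>"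
    have "\<phi> (N.lincomb a ?B) = (\<Sum>v\<in>?B. \<phi> (a v \<odot>\<^bsub>N\<^esub> v))"
      unfolding N.lincomb_def
      by (rule hom_finsum[OF N.abelian_monoid_axioms]) (use B smult_car add \<phi>0 in auto)
    also have "\<dots> = (\<Sum>v\<in>?B. scale (a v) (\<phi> v))" using B by (intro sum.cong) (auto simp: smult)
    also have "\<dots> = (\<Sum>i\<in>S. Poly_Mapping.single i (a (f (Poly_Mapping.single i 1))))"
      by (simp add: sum.reindex[OF inj_f] fS)
    finally have 0: "(\<Sum>i\<in>S. Poly_Mapping.single i (a (f (Poly_Mapping.single i 1)))) = 0"
      by (simp add: a \<phi>0)
    have "a (f (Poly_Mapping.single j 1)) = 0" if "j \<in> S" for j
      using arg_cong[OF 0, of "\<lambda>v. Poly_Mapping.lookup v j"] that fin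
      by (simp add: lookup_sum lookup_single when_def)
    then show "\<forall>v\<in>?B. a v = \<zero>\<^bsub>class_ring\<^esub>" by auto
  qed
  with gen B have basis: "N.basis ?B" by (simp add: N.basis_def)
  show "N.fin_dim" unfolding N.fin_dim_def using fin gen B by (intro exI[of _ ?B]) auto
  show "N.dim = card S"
    using N.dim_basis[OF finite_imageI[OF fin] basis] card_image[OF inj_f] by simp
qed

section \<open>Quantum integers and ladder modules\<close>

text \<open>The quantum integer \<open>[k]\<close>, for negative \<open>k\<close> as well.\<close>

definition qint :: "complex \<Rightarrow> int \<Rightarrow> complex" where
  "qint q k = (q powi k - q powi (- k)) / (q - inverse q)"

lemma qint_zero [simp]: "qint q 0 = 0" by (simp add: qint_def)

lemma qint_uminus: "qint q (- k) = - qint q k"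
  by (simp add: qint_def minus_divide_left)

lemma qint_one: "q - inverse q \<noteq> 0 \<Longrightarrow> qint q 1 = 1"
  by (simp add: qint_def)

text \<open>The only identity between quantum integers that the computation of the action uses: each of
  the recursions for the coefficients of \<open>e\<close> and \<open>f\<close> is an instance of it, as is the subtraction that
  produces \<open>[n - p]\<close>.\<close>

lemma qint_add:
  assumes "q \<noteq> 0"
  shows "qint q (a + b) = q powi a * qint q b + q powi (- b) * qint q a"
proof -
  have "q powi (a + b) - q powi (- (a + b))
      = q powi a * (q powi b - q powi (- b)) + q powi (- b) * (q powi a - q powi (- a))"
    using power_int_add[of q a b] power_int_add[of q "- a" "- b"] assms by (simp add: algebra_simps)
  then show ?thesis
    unfolding qint_def times_divide_eq_right add_divide_distrib[symmetric] by (rule arg_cong)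
qed

locale generic_q =
  fixes q :: complex
  assumes q_nonzero: "q \<noteq> 0"
    and q_not_root_of_unity: "\<forall>m::nat. m > 0 \<longrightarrow> q ^ m \<noteq> 1"
begin

lemma powi_ne_one: "k \<noteq> 0 \<Longrightarrow> q powi k \<noteq> 1"
proof (cases "k \<ge> 0")
  case True
  assume "k \<noteq> 0"
  then show ?thesis using True q_not_root_of_unity[rule_format, of "nat k"] by (simp add: power_int_def)
next
  case False
  then have "q ^ nat (- k) \<noteq> 1" using q_not_root_of_unity by simp
  then show ?thesis using False by (simp add: power_int_def power_inverse)
qed

lemma qint_nonzero: "k \<noteq> 0 \<Longrightarrow> qint q k \<noteq> 0"
proof -
  assume k: "k \<noteq> 0"
  have ne: "q powi j \<noteq> q powi (- j)" if "j \<noteq> 0" for j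
  proof
    assume eq: "q powi j = q powi (- j)"
    have "q powi j * q powi (- j) = 1" by (simp add: q_nonzero power_int_minus)
    then have "q powi j * q powi j = 1" unfolding eq[symmetric] .
    then have "q powi (j + j) = 1" using power_int_add[of q j j] q_nonzero by simp
    then show False using powi_ne_one[of "j + j"] that by simp
  qed
  have "q - inverse q \<noteq> 0" using ne[of 1] by (simp add: power_int_minus)
  then show ?thesis using ne[OF k] by (simp add: qint_def)
qed

lemma q_minus_inverse_nonzero: "q - inverse q \<noteq> 0"
  using qint_nonzero[of 1] by (auto simp: qint_def)

lemma qint_1 [simp]: "qint q 1 = 1"
  by (rule qint_one[OF q_minus_inverse_nonzero])

end

text \<open>The lowering operator strictly decreases the highest index that occurs in a vector and
  annihilates nothing of positive height, so after finitely many applications a nonzero multiple of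
  the bottom vector remains.\<close>

lemma lowering_reaches_bottom:
  assumes scale: "\<And>c u. u \<in> U \<Longrightarrow> scale c u \<in> U" and lower: "\<And>u. u \<in> U \<Longrightarrow> lin b u \<in> U"
    and b0: "b 0 = 0" and bS: "\<And>i. Suc i \<in> S \<Longrightarrow> i \<in> S \<and> \<epsilon> i \<noteq> 0 \<and> b (Suc i) = Poly_Mapping.single i (\<epsilon> i)"
    and w: "w \<in> U" "w \<noteq> 0" "Poly_Mapping.keys w \<subseteq> S"
  shows "Poly_Mapping.single 0 1 \<in> U"
proof -
  have "w \<in> U \<Longrightarrow> w \<noteq> 0 \<Longrightarrow> Poly_Mapping.keys w \<subseteq> S \<Longrightarrow> Poly_Mapping.keys w \<subseteq> {..d} \<Longrightarrow> Poly_Mapping.single 0 1 \<in> U"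
    for w d
  proof (induction d arbitrary: w)
    case 0
    let ?a = "Poly_Mapping.lookup w 0"
    have w: "w = Poly_Mapping.single 0 ?a"
      using 0(4) by (intro poly_mapping_eqI) (auto simp: lookup_single when_def in_keys_iff)
    then have "?a \<noteq> 0" using 0(2) by (metis single_zero)
    then have "scale (inverse ?a) w = Poly_Mapping.single 0 1" by (subst w) simp
    then show ?case using scale[OF 0(1), of "inverse ?a"] by simp
  next
    case (Suc d)
    show ?case
    proof (cases "Suc d \<in> Poly_Mapping.keys w")
      case False
      then have "Poly_Mapping.keys w \<subseteq> {..d}" using Suc.prems(4) by (auto simp: le_Suc_eq)
      then show ?thesis using Suc by blast
    next
      case True
      have l: "Poly_Mapping.lookup (lin b w) j
          = (if Suc j \<in> Poly_Mapping.keys w then Poly_Mapping.lookup w (Suc j) * \<epsilon> j else 0)" for j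
      proof -
        have "Poly_Mapping.lookup (lin b w) j
            = (\<Sum>i\<in>Poly_Mapping.keys w. if i = Suc j then Poly_Mapping.lookup w i * \<epsilon> j else 0)"
          unfolding lookup_lin
        proof (intro sum.cong refl)
          fix i assume "i \<in> Poly_Mapping.keys w"
          then show "Poly_Mapping.lookup w i * Poly_Mapping.lookup (b i) j = (if i = Suc j then Poly_Mapping.lookup w i * \<epsilon> j else 0)"
            using b0 bS Suc.prems(3) by (cases i) (auto simp: lookup_single when_def subset_iff)
        qed
        then show ?thesis by simp
      qed
      have "Poly_Mapping.lookup (lin b w) d \<noteq> 0" using True bS Suc.prems(3) by (auto simp: l in_keys_iff)
      then have "lin b w \<noteq> 0" by auto
      moreover have "Poly_Mapping.keys (lin b w) \<subseteq> S \<inter> {..d}"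
        using bS Suc.prems(3,4) by (auto simp: in_keys_iff l subset_iff split: if_splits)
      ultimately show ?thesis using Suc.IH[OF lower[OF Suc.prems(1)]] by blast
    qed
  qed
  moreover have "Poly_Mapping.keys w \<subseteq> {..Max (Poly_Mapping.keys w)}" by auto
  ultimately show ?thesis using w by blast
qed

text \<open>A nonzero submodule contains the bottom vector by \<open>lowering_reaches_bottom\<close>, and the raising
  operator reaches every basis vector from there.\<close>

lemma ladder_simple:
  assumes N: "uq_module q (basis_module S b)"
    and act: "\<And>g w. Poly_Mapping.keys w \<subseteq> S \<Longrightarrow> act (basis_module S b) (uq_class q (gen g)) w = lin (b g) w"
    and S0: "0 \<in> S" and e0: "b ge 0 = 0"
    and e: "\<And>i. Suc i \<in> S \<Longrightarrow> i \<in> S \<and> \<epsilon> i \<noteq> 0 \<and> b ge (Suc i) = Poly_Mapping.single i (\<epsilon> i)"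
    and f: "\<And>i. Suc i \<in> S \<Longrightarrow> \<eta> i \<noteq> 0 \<and> b gf i = Poly_Mapping.single (Suc i) (\<eta> i)"
  shows "uq_simple q (basis_module S b)"
proof -
  let ?B = "basis_module S b"
  have "carrier ?B \<noteq> {\<zero>\<^bsub>?B\<^esub>}"
  proof
    assume "carrier ?B = {\<zero>\<^bsub>?B\<^esub>}"
    moreover have "Poly_Mapping.single 0 1 \<in> carrier ?B" using S0 by simp
    ultimately have "Poly_Mapping.single 0 (1::complex) = (0 :: nat \<Rightarrow>\<^sub>0 complex)" by auto
    then show False by (metis lookup_single_eq lookup_zero zero_neq_one)
  qed
  moreover have "W = carrier ?B" if W: "uq_submodule q W ?B" and nz: "W \<noteq> {\<zero>\<^bsub>?B\<^esub>}" for W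
  proof -
    interpret W: submodule class_ring W ?B using W by (simp add: uq_submodule_def)
    have sub: "Poly_Mapping.keys w \<subseteq> S" if "w \<in> W" for w using W.subset that by auto
    have sc: "scale c w \<in> W" if "w \<in> W" for c w using W.smult_closed[of c w] that by simp
    have gen: "lin (b g) w \<in> W" if "w \<in> W" for g w
      using W that act[OF sub[OF that], of g] by (metis uq_class_in_Uq uq_submodule_def)
    obtain w where w: "w \<in> W" "w \<noteq> 0" using nz W.zero_closed by auto
    have bottom: "Poly_Mapping.single 0 1 \<in> W"
      by (rule lowering_reaches_bottom[OF sc gen e0 e w sub[OF w(1)]])
    have basis: "i \<in> S \<Longrightarrow> Poly_Mapping.single i 1 \<in> W" for i
    proof (induction i)
      case 0
      show ?case by (rule bottom)
    next
      case (Suc i)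
      have "Poly_Mapping.single i 1 \<in> W" using Suc e by blast
      then have "scale (inverse (\<eta> i)) (lin (b gf) (Poly_Mapping.single i 1)) \<in> W" by (intro sc gen)
      then show ?case using f[OF Suc.prems] by simp
    qed
    have "w \<in> W" if w: "Poly_Mapping.keys w \<subseteq> S" for w
    proof -
      have "(\<Sum>i\<in>A. scale (Poly_Mapping.lookup w i) (Poly_Mapping.single i 1)) \<in> W"
        if "finite A" "A \<subseteq> S" for A
        using that
      proof (induction A)
        case empty
        show ?case using W.zero_closed by simp
      next
        case (insert i A)
        then show ?case using W.m_closed[OF sc[OF basis, of i]] by (simp del: scale_single)
      qed
      from this[OF finite_keys w] have "lin (\<lambda>i. Poly_Mapping.single i 1) w \<in> W"
        unfolding lin_def .
      then show ?thesis by simp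
    qed
    then show ?thesis using W.subset by auto
  qed
  ultimately show ?thesis using N by (auto simp: uq_simple_def)
qed

lemma V1_gen_qint:
  "V1_gen q n ge (Suc p) = Poly_Mapping.single p (qint q (int n - int p))"
  "V1_gen q n gf p = (if p < n then Poly_Mapping.single (Suc p) (qint q (int p + 1)) else 0)"
  by (simp_all add: qint_def)

lemma verma_gen_qint:
  assumes "q \<noteq> 0"
  shows "verma_gen q (q powi (- int n - 2)) gk i = Poly_Mapping.single i (q powi (- int n - 2 - 2 * int i))"
    "verma_gen q (q powi (- int n - 2)) gki i = Poly_Mapping.single i (q powi (int n + 2 + 2 * int i))"
    "verma_gen q (q powi (- int n - 2)) ge (Suc i) = Poly_Mapping.single i (qint q (- int n - 2 - int i))"
    "verma_gen q (q powi (- int n - 2)) gf i = Poly_Mapping.single (Suc i) (qint q (int i + 1))"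
proof -
  have inv: "inverse (q powi (- int n - 2)) = q powi (int n + 2)"
    using power_int_minus[of q "- int n - 2", symmetric] by (simp add: add.commute)
  note add = power_int_add[OF disjI1[OF assms], symmetric]
  show "verma_gen q (q powi (- int n - 2)) gk i = Poly_Mapping.single i (q powi (- int n - 2 - 2 * int i))"
    using add[of "- int n - 2" "- 2 * int i"] by simp
  show "verma_gen q (q powi (- int n - 2)) gki i = Poly_Mapping.single i (q powi (int n + 2 + 2 * int i))"
    unfolding verma_gen.simps inv using add[of "int n + 2" "2 * int i"] by simp
  show "verma_gen q (q powi (- int n - 2)) ge (Suc i) = Poly_Mapping.single i (qint q (- int n - 2 - int i))"
  proof -
    have "q powi (- int n - 2) * q powi (- int i) = q powi (- int n - 2 - int i)"
      unfolding add by (rule arg_cong[of _ _ "power_int q"]) simp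
    moreover have "q powi (int n + 2) * q powi (int i) = q powi (- (- int n - 2 - int i))"
      unfolding add by (rule arg_cong[of _ _ "power_int q"]) simp
    ultimately show ?thesis unfolding verma_gen.simps inv qint_def by (simp only:)
  qed
  show "verma_gen q (q powi (- int n - 2)) gf i = Poly_Mapping.single (Suc i) (qint q (int i + 1))"
    by (simp add: qint_def)
qed

section \<open>The action on monomials\<close>

text \<open>The formulas that \<open>gact_monomial\<close> establishes for the action on \<open>x\<^sup>n y\<^sup>p\<close>, in the
  coordinate \<open>p\<close> for fixed \<open>n\<close>.\<close>

fun slice_gen :: "complex \<Rightarrow> complex \<Rightarrow> nat \<Rightarrow> uq_gen \<Rightarrow> nat \<Rightarrow> (nat \<Rightarrow>\<^sub>0 complex)" where
  "slice_gen q b0 n gk p = Poly_Mapping.single p (q powi (int n - 2 * int p))"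
| "slice_gen q b0 n gki p = Poly_Mapping.single p (q powi (2 * int p - int n))"
| "slice_gen q b0 n ge p = (if p = 0 then 0 else
     Poly_Mapping.single (p - 1) (b0 * q powi (1 - int p) * qint q (int p)))"
| "slice_gen q b0 n gf p =
     Poly_Mapping.single (Suc p) (inverse b0 * q powi (int p) * qint q (int n - int p))"

definition plane_gen :: "complex \<Rightarrow> complex \<Rightarrow> uq_gen \<Rightarrow> nat \<times> nat \<Rightarrow> (nat \<times> nat \<Rightarrow>\<^sub>0 complex)" where
  "plane_gen q b0 g i = lin (\<lambda>p. Poly_Mapping.single (fst i, p) 1) (slice_gen q b0 (fst i) g (snd i))"

lemma tensor_single:
  "tensor (Poly_Mapping.single u 1) (Poly_Mapping.single v 1) = Poly_Mapping.single (u, v) 1"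
  by (simp add: tensor_def)

lemma tensor_gen:
  "tensor (gen g) (gen g') = Poly_Mapping.single (Word [g], Word [g']) 1"
  "tensor 1 (gen g) = Poly_Mapping.single (0, Word [g]) 1"
  "tensor (gen g) 1 = Poly_Mapping.single (Word [g], 0) 1"
  using tensor_single[of 0 "Word [g]"] tensor_single[of "Word [g]" 0]
  by (simp_all add: gen_def tensor_single)

text \<open>The product rule of a module algebra holds for every representative of the
  coproduct; the defining formula for a generator is one of them.\<close>

lemma comult_gen_in_comult: "comult_gen g \<in> comult q (uq_class q (gen g))"
proof -
  have "ideal (uq2_ideal q) class_ring"
    unfolding uq2_ideal_def by (rule ring.genideal_ideal[OF class_ring.ring_axioms]) simp
  then have "comult_gen g \<in> uq2_ideal q +>\<^bsub>class_ring\<^esub> comult_gen g"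
    by (simp add: mem_class_coset ideal_closed)
  moreover have "free_lift (Poly_Mapping.single 0) comult_gen (gen g) = comult_gen g"
    by (simp add: free_lift_def gen_def)
  moreover have "gen g \<in> uq_class q (gen g)" by (simp add: uq_class_def)
  ultimately show ?thesis unfolding comult_def by force
qed

locale qplane_action = generic_q q for q :: complex +
  fixes b0 :: complex
    and \<pi> :: "uq_gen free_alg set \<Rightarrow> qp_gen free_alg set \<Rightarrow> qp_gen free_alg set"
    and M :: "qp_gen free_alg set uq_module"
  assumes b0_nonzero: "b0 \<noteq> 0"
    and M_eq: "M = with_action (qplane q) \<pi>"
    and module_algebra: "uq_module_algebra q M"
    and k_x: "\<pi> (uq_class q (gen gk)) (qp_x q) = q \<odot>\<^bsub>qplane q\<^esub> qp_x q"
    and k_y: "\<pi> (uq_class q (gen gk)) (qp_y q) = q powi (-2) \<odot>\<^bsub>qplane q\<^esub> qp_y q"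
    and e_x: "\<pi> (uq_class q (gen ge)) (qp_x q) = \<zero>\<^bsub>qplane q\<^esub>"
    and e_y: "\<pi> (uq_class q (gen ge)) (qp_y q) = b0 \<odot>\<^bsub>qplane q\<^esub> \<one>\<^bsub>qplane q\<^esub>"
    and f_x: "\<pi> (uq_class q (gen gf)) (qp_x q) =
                inverse b0 \<odot>\<^bsub>qplane q\<^esub> (qp_x q \<otimes>\<^bsub>qplane q\<^esub> qp_y q)"
    and f_y: "\<pi> (uq_class q (gen gf)) (qp_y q) =
                (- q * inverse b0) \<odot>\<^bsub>qplane q\<^esub> (qp_y q [^]\<^bsub>qplane q\<^esub> (2::nat))"
begin

sublocale M: uq_module_algebra q M by (rule module_algebra)

abbreviation cl :: "qp_gen free_alg \<Rightarrow> qp_gen free_alg set" where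
  "cl \<equiv> residue (qp_relators q)"

abbreviation gact :: "uq_gen \<Rightarrow> qp_gen free_alg set \<Rightarrow> qp_gen free_alg set" where
  "gact g \<equiv> act M (uq_class q (gen g))"

lemma M_simps [simp]:
  "carrier M = range cl" "\<one>\<^bsub>M\<^esub> = cl 1" "\<zero>\<^bsub>M\<^esub> = cl 0"
  "cl r \<oplus>\<^bsub>M\<^esub> cl s = cl (r + s)" "cl r \<otimes>\<^bsub>M\<^esub> cl s = cl (r * s)" "c \<odot>\<^bsub>M\<^esub> cl r = cl (scale c r)"
  by (simp_all add: M_eq with_action_def qplane_def presented_algebra_simps)

lemma gact_on_class: "\<exists>r'. gact g (cl r) = cl r'"
  using M.act_closed[of "uq_class q (gen g)" "cl r"] by auto

lemma gact_scale: "gact g (cl (scale c r)) = c \<odot>\<^bsub>M\<^esub> gact g (cl r)"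
  using M.act_vector_smult[of "uq_class q (gen g)" "cl r" c] by simp

lemma gact_add: "gact g (cl (r + s)) = gact g (cl r) \<oplus>\<^bsub>M\<^esub> gact g (cl s)"
  using M.act_vector_add[of "uq_class q (gen g)" "cl r" "cl s"] by simp

lemma act_single_word:
  "act M (uq_class q (Poly_Mapping.single (Word [g]) 1)) v = gact g v"
  by (simp add: gen_def)

lemma act_single_empty: "act M (uq_class q 1) (cl r) = cl r"
  using M.act_one[of "cl r"] by (simp add: Uq_simps)

text \<open>The general product rule, a sum over the support of a tensor, specialized to a coproduct
  with two summands.\<close>

lemma act_product_two_terms:
  assumes "comult_gen g = Poly_Mapping.single (u, v) 1 + Poly_Mapping.single (u', v') 1" "(u, v) \<noteq> (u', v')"
  shows "gact g (cl r \<otimes>\<^bsub>M\<^esub> cl s) =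
    (act M (uq_class q (Poly_Mapping.single u 1)) (cl r) \<otimes>\<^bsub>M\<^esub> act M (uq_class q (Poly_Mapping.single v 1)) (cl s))
    \<oplus>\<^bsub>M\<^esub> (act M (uq_class q (Poly_Mapping.single u' 1)) (cl r) \<otimes>\<^bsub>M\<^esub> act M (uq_class q (Poly_Mapping.single v' 1)) (cl s))"
proof -
  let ?t = "Poly_Mapping.single (u, v) 1 + Poly_Mapping.single (u', v') (1::complex)"
  have l: "Poly_Mapping.lookup ?t w = (if w = (u, v) \<or> w = (u', v') then 1 else 0)" for w
    using assms(2) by (auto simp: lookup_add lookup_single when_def)
  have k: "Poly_Mapping.keys ?t = {(u, v), (u', v')}"
    by (auto simp: in_keys_iff l split: if_splits)
  have car0: "cl r \<in> carrier M" for r by simp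
  have car: "\<exists>r'. act M (uq_class q x) (cl r) = cl r'" for x r
    using M.act_closed[of "uq_class q x" "cl r"] by auto
  have car2: "act M (uq_class q x) (cl r) \<otimes>\<^bsub>M\<^esub> act M (uq_class q y) (cl s) \<in> carrier M" for x y
    using car[of x r] car[of y s] by auto
  have one: "1 \<odot>\<^bsub>M\<^esub> z = z" if "z \<in> carrier M" for z using M.smult_one[OF that] by simp
  show ?thesis
    using M.act_product[OF uq_class_in_Uq comult_gen_in_comult car0 car0, of g r s] assms(2) car2
    unfolding assms(1) k by (simp add: l one[OF car2] del: M_simps)
qed

lemma act_product_one_term:
  assumes "comult_gen g = Poly_Mapping.single (u, v) 1"
  shows "gact g (cl r \<otimes>\<^bsub>M\<^esub> cl s) =
    act M (uq_class q (Poly_Mapping.single u 1)) (cl r) \<otimes>\<^bsub>M\<^esub> act M (uq_class q (Poly_Mapping.single v 1)) (cl s)"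
proof -
  have car0: "cl r \<in> carrier M" for r by simp
  have car: "\<exists>r'. act M (uq_class q x) (cl r) = cl r'" for x r
    using M.act_closed[of "uq_class q x" "cl r"] by auto
  have car2: "act M (uq_class q x) (cl r) \<otimes>\<^bsub>M\<^esub> act M (uq_class q y) (cl s) \<in> carrier M" for x y
    using car[of x r] car[of y s] by auto
  have one: "1 \<odot>\<^bsub>M\<^esub> z = z" if "z \<in> carrier M" for z using M.smult_one[OF that] by simp
  show ?thesis
    using M.act_product[OF uq_class_in_Uq comult_gen_in_comult car0 car0, of g r s] car2
    unfolding assms(1) by (simp add: one[OF car2] del: M_simps)
qed

lemma product_rules:
  "gact gk (cl (r * s)) = gact gk (cl r) \<otimes>\<^bsub>M\<^esub> gact gk (cl s)"
  "gact gki (cl (r * s)) = gact gki (cl r) \<otimes>\<^bsub>M\<^esub> gact gki (cl s)"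
  "gact ge (cl (r * s)) = (cl r \<otimes>\<^bsub>M\<^esub> gact ge (cl s)) \<oplus>\<^bsub>M\<^esub> (gact ge (cl r) \<otimes>\<^bsub>M\<^esub> gact gk (cl s))"
  "gact gf (cl (r * s)) = (gact gf (cl r) \<otimes>\<^bsub>M\<^esub> cl s) \<oplus>\<^bsub>M\<^esub> (gact gki (cl r) \<otimes>\<^bsub>M\<^esub> gact gf (cl s))"
proof -
  have w: "Word [g] \<noteq> 0" for g :: uq_gen by (simp add: zero_word_def)
  show "gact gk (cl (r * s)) = gact gk (cl r) \<otimes>\<^bsub>M\<^esub> gact gk (cl s)"
    using act_product_one_term[of gk "Word [gk]" "Word [gk]" r s] by (simp add: tensor_gen act_single_word)
  show "gact gki (cl (r * s)) = gact gki (cl r) \<otimes>\<^bsub>M\<^esub> gact gki (cl s)"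
    using act_product_one_term[of gki "Word [gki]" "Word [gki]" r s] by (simp add: tensor_gen act_single_word)
  show "gact ge (cl (r * s)) = (cl r \<otimes>\<^bsub>M\<^esub> gact ge (cl s)) \<oplus>\<^bsub>M\<^esub> (gact ge (cl r) \<otimes>\<^bsub>M\<^esub> gact gk (cl s))"
    using act_product_two_terms[of ge 0 "Word [ge]" "Word [ge]" "Word [gk]" r s]
    by (simp add: tensor_gen act_single_word act_single_empty w)
  show "gact gf (cl (r * s)) = (gact gf (cl r) \<otimes>\<^bsub>M\<^esub> cl s) \<oplus>\<^bsub>M\<^esub> (gact gki (cl r) \<otimes>\<^bsub>M\<^esub> gact gf (cl s))"
    using act_product_two_terms[of gf "Word [gf]" 0 "Word [gki]" "Word [gf]" r s]
    by (simp add: tensor_gen act_single_word act_single_empty w)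
qed

lemma k_inverse: "gact gki (gact gk (cl r)) = cl r" "gact gk (gact gki (cl r)) = cl r"
proof -
  have rel: "uq_class q (gen gki * gen gk) = uq_class q 1" "uq_class q (gen gk * gen gki) = uq_class q 1"
    unfolding uq_class_def residue_eq_iff by (rule relators_in_ideal, simp add: uq_relators_def)+
  show "gact gki (gact gk (cl r)) = cl r" "gact gk (gact gki (cl r)) = cl r"
    using M.act_mult[of "uq_class q (gen gki)" "uq_class q (gen gk)" "cl r"]
      M.act_mult[of "uq_class q (gen gk)" "uq_class q (gen gki)" "cl r"]
    by (simp_all add: Uq_simps rel act_single_empty)
qed

lemma gact_generators:
  "gact gk (cl (gen gx)) = cl (scale q (gen gx))"
  "gact gk (cl (gen gy)) = cl (scale (q powi (-2)) (gen gy))"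
  "gact ge (cl (gen gx)) = cl 0"
  "gact ge (cl (gen gy)) = cl (scale b0 1)"
  "gact gf (cl (gen gx)) = cl (scale (inverse b0) (gen gx * gen gy))"
  "gact gf (cl (gen gy)) = cl (scale (- q * inverse b0) (gen gy ^ 2))"
proof -
  have "act M = \<pi>" by (simp add: M_eq with_action_def)
  then show "gact gk (cl (gen gx)) = cl (scale q (gen gx))"
    "gact gk (cl (gen gy)) = cl (scale (q powi (-2)) (gen gy))"
    "gact ge (cl (gen gx)) = cl 0"
    "gact ge (cl (gen gy)) = cl (scale b0 1)"
    "gact gf (cl (gen gx)) = cl (scale (inverse b0) (gen gx * gen gy))"
    "gact gf (cl (gen gy)) = cl (scale (- q * inverse b0) (gen gy ^ 2))"
    using k_x k_y e_x e_y f_x f_y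
    by (simp_all only: qp_x_def qp_y_def qplane_def presented_algebra_simps presented_algebra_pow)
qed

text \<open>The action on the unit follows from the product rule: applying \<open>k\<close> to
  \<open>k\<inverse>(1) = k\<inverse>(1) 1\<close> gives \<open>1 = 1 k(1)\<close>, and then \<open>e(1) = e(1 1)\<close> becomes \<open>e(1) = 2 e(1)\<close>; likewise
  for \<open>f\<close>.\<close>

lemma gact_unit:
  "gact gk (cl 1) = cl 1" "gact gki (cl 1) = cl 1" "gact ge (cl 1) = cl 0" "gact gf (cl 1) = cl 0"
proof -
  obtain a where a: "gact gki (cl 1) = cl a" using gact_on_class by blast
  obtain u where u: "gact gk (cl 1) = cl u" using gact_on_class by blast
  have "cl 1 = gact gk (cl (a * 1))" using k_inverse(2)[of 1] a by simp
  also have "\<dots> = gact gk (cl a) \<otimes>\<^bsub>M\<^esub> gact gk (cl 1)" by (rule product_rules)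
  also have "\<dots> = cl 1 \<otimes>\<^bsub>M\<^esub> cl u" using k_inverse(2)[of 1] a u by simp
  finally show k: "gact gk (cl 1) = cl 1" using u by simp
  show ki: "gact gki (cl 1) = cl 1" using k_inverse(1)[of 1] k by simp
  have double: "cl r = cl 0" if "cl r = cl (r + r)" for r
    using that ideal_closed(5)[OF ideal_relation_ideal, of "-r" "qp_relators q"] by (simp add: residue_eq_iff)
  obtain r where r: "gact ge (cl 1) = cl r" using gact_on_class by blast
  then show "gact ge (cl 1) = cl 0" using product_rules(3)[of 1 1] k double by simp
  obtain s where s: "gact gf (cl 1) = cl s" using gact_on_class by blast
  then show "gact gf (cl 1) = cl 0" using product_rules(4)[of 1 1] ki double by simp
qed

text \<open>By induction on \<open>m\<close>, splitting off one factor \<open>x\<close> on the left. The values at \<open>k\<inverse>\<close> come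
  from those at \<open>k\<close>.\<close>

lemma gact_x_power:
  "gact gk (cl (gen gx ^ m)) = cl (scale (q powi int m) (gen gx ^ m))"
  "gact gki (cl (gen gx ^ m)) = cl (scale (q powi - int m) (gen gx ^ m))"
  "gact ge (cl (gen gx ^ m)) = cl 0"
  "gact gf (cl (gen gx ^ m)) = cl (scale (inverse b0 * qint q (int m)) (gen gx ^ m * gen gy))"
proof -
  show k: "gact gk (cl (gen gx ^ m)) = cl (scale (q powi int m) (gen gx ^ m))" for m
    by (induction m)
      (simp_all add: gact_unit product_rules gact_generators scale_mult scale_commute_mult mult.commute
        del: of_nat_Suc)
  show ki: "gact gki (cl (gen gx ^ m)) = cl (scale (q powi - int m) (gen gx ^ m))" for m
  proof -
    have "cl (scale (q powi int m * q powi - int m) (gen gx ^ m)) = gact gk (cl (scale (q powi - int m) (gen gx ^ m)))"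
      by (simp add: gact_scale k mult.commute)
    then have "cl (gen gx ^ m) = gact gk (cl (scale (q powi - int m) (gen gx ^ m)))"
      by (simp add: q_nonzero power_int_minus)
    then show ?thesis by (metis k_inverse(1))
  qed
  show "gact ge (cl (gen gx ^ m)) = cl 0"
  proof (induction m)
    case (Suc m)
    then show ?case by (simp add: product_rules gact_generators k)
  qed (simp add: gact_unit)
  show "gact gf (cl (gen gx ^ m)) = cl (scale (inverse b0 * qint q (int m)) (gen gx ^ m * gen gy))"
  proof (induction m)
    case 0
    show ?case by (simp add: gact_unit)
  next
    case (Suc m)
    have "gact gf (cl (gen gx ^ Suc m))
        = cl (scale (inverse b0) (gen gx * (gen gy * gen gx ^ m)))
          \<oplus>\<^bsub>M\<^esub> cl (scale (inverse q * (inverse b0 * qint q (int m))) (gen gx ^ Suc m * gen gy))"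
      using ki[of 1]
      by (simp add: product_rules gact_generators Suc scale_mult scale_commute_mult ac_simps power_int_minus)
    also have "cl (scale (inverse b0) (gen gx * (gen gy * gen gx ^ m)))
        = cl (scale (inverse b0) (gen gx * scale (q ^ m) (gen gx ^ m * gen gy)))"
      by (intro residue_cong qp_commute refl)
    also have "\<dots> = cl (scale (inverse b0 * q ^ m) (gen gx ^ Suc m * gen gy))"
      by (simp add: scale_commute_mult mult.assoc)
    also have "\<dots> \<oplus>\<^bsub>M\<^esub> cl (scale (inverse q * (inverse b0 * qint q (int m))) (gen gx ^ Suc m * gen gy))
       = cl (scale (inverse b0 * q ^ m + inverse q * (inverse b0 * qint q (int m))) (gen gx ^ Suc m * gen gy))"
      by (simp add: scale_add_left)
    also have "inverse b0 * q ^ m + inverse q * (inverse b0 * qint q (int m)) = inverse b0 * qint q (int (Suc m))"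
      using qint_add[OF q_nonzero, of "int m" 1] by (simp add: algebra_simps power_int_minus)
    finally show ?case .
  qed
qed

lemma gact_y_power:
  "gact gk (cl (gen gy ^ p)) = cl (scale (q powi (- 2 * int p)) (gen gy ^ p))"
  "gact gki (cl (gen gy ^ p)) = cl (scale (q powi (2 * int p)) (gen gy ^ p))"
  "gact ge (cl (gen gy ^ Suc p)) = cl (scale (b0 * q powi (- int p) * qint q (int p + 1)) (gen gy ^ p))"
  "gact gf (cl (gen gy ^ p)) = cl (scale (- inverse b0 * q powi (int p) * qint q (int p)) (gen gy ^ Suc p))"
proof -
  show k: "gact gk (cl (gen gy ^ p)) = cl (scale (q powi (- 2 * int p)) (gen gy ^ p))" for p
  proof (induction p)
    case (Suc p)
    have "q powi (- 2 * int (Suc p)) = q powi (-2) * q powi (- 2 * int p)"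
      using power_int_add[of q "-2" "- 2 * int p"] q_nonzero by (simp add: algebra_simps)
    then show ?case using Suc
      by (simp add: product_rules gact_generators scale_mult scale_commute_mult mult.commute del: of_nat_Suc)
  qed (simp add: gact_unit)
  show ki: "gact gki (cl (gen gy ^ p)) = cl (scale (q powi (2 * int p)) (gen gy ^ p))" for p
  proof -
    have "q powi (2 * int p) * q powi (- 2 * int p) = 1"
      using power_int_add[of q "2 * int p" "- 2 * int p"] q_nonzero by simp
    then have "cl (gen gy ^ p) = gact gk (cl (scale (q powi (2 * int p)) (gen gy ^ p)))"
      by (simp add: gact_scale k)
    then show ?thesis by (metis k_inverse(1))
  qed
  show "gact ge (cl (gen gy ^ Suc p)) = cl (scale (b0 * q powi (- int p) * qint q (int p + 1)) (gen gy ^ p))"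
  proof (induction p)
    case 0
    show ?case by (simp add: gact_generators)
  next
    case (Suc p)
    have eq: "b0 * q powi (- int p) * qint q (int p + 1) + b0 * q powi (- 2 * int (Suc p))
        = b0 * q powi (- int (Suc p)) * qint q (int (Suc p) + 1)"
    proof -
      have "q powi (- 2 * int (Suc p)) = q powi (- int (Suc p)) * q powi (- int (Suc p))"
        using power_int_add[of q "- int (Suc p)" "- int (Suc p)"] q_nonzero by (simp add: algebra_simps)
      moreover have "q powi (- int p) = q powi (- int (Suc p)) * q"
        using power_int_add[of q "- int (Suc p)" 1] q_nonzero by simp
      moreover have "qint q (int (Suc p) + 1) = q * qint q (int (Suc p)) + q powi (- int (Suc p))"
        using qint_add[OF q_nonzero, of 1 "int (Suc p)"] by (simp add: add.commute)
      ultimately show ?thesis by (simp add: algebra_simps)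
    qed
    have "gact ge (cl (gen gy ^ Suc (Suc p))) = gact ge (cl (gen gy * gen gy ^ Suc p))" by simp
    also have "\<dots> = cl (gen gy) \<otimes>\<^bsub>M\<^esub> gact ge (cl (gen gy ^ Suc p)) \<oplus>\<^bsub>M\<^esub> gact ge (cl (gen gy)) \<otimes>\<^bsub>M\<^esub> gact gk (cl (gen gy ^ Suc p))"
      by (rule product_rules)
    also have "\<dots> = cl (scale (b0 * q powi (- int p) * qint q (int p + 1) + b0 * q powi (- 2 * int (Suc p))) (gen gy ^ Suc p))"
      unfolding Suc.IH gact_generators k
      by (simp add: scale_mult scale_commute_mult scale_add_left mult.commute)
    finally show ?case unfolding eq .
  qed
  show "gact gf (cl (gen gy ^ p)) = cl (scale (- inverse b0 * q powi (int p) * qint q (int p)) (gen gy ^ Suc p))"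
  proof (induction p)
    case 0
    show ?case by (simp add: gact_unit)
  next
    case (Suc p)
    have ki1: "gact gki (cl (gen gy)) = cl (scale (q powi 2) (gen gy))" using ki[of 1] by simp
    have eq: "- q * inverse b0 + q powi 2 * (- inverse b0 * q powi (int p) * qint q (int p))
        = - inverse b0 * q powi (int (Suc p)) * qint q (int (Suc p))"
    proof -
      have P: "q powi (int (Suc p)) = q * q powi (int p)"
        using power_int_add[of q 1 "int p"] q_nonzero by simp
      have Q: "qint q (int (Suc p)) = q * qint q (int p) + q powi (- int p)"
        using qint_add[OF q_nonzero, of 1 "int p"] by (simp add: add.commute)
      have inv: "q powi (int p) * q powi (- int p) = 1"
        using power_int_add[of q "int p" "- int p"] q_nonzero by simp
      have "q powi (int (Suc p)) * qint q (int (Suc p))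
          = q * (q powi (int p) * q powi (- int p)) + q * q * (q powi int p * qint q (int p))"
        unfolding P Q by (simp only: distrib_left ac_simps)
      then have "q powi (int (Suc p)) * qint q (int (Suc p)) = q + q * q * (q powi int p * qint q (int p))"
        unfolding inv by simp
      then show ?thesis by (simp add: algebra_simps power2_eq_square)
    qed
    have "gact gf (cl (gen gy ^ Suc p)) = gact gf (cl (gen gy * gen gy ^ p))" by simp
    also have "\<dots> = gact gf (cl (gen gy)) \<otimes>\<^bsub>M\<^esub> cl (gen gy ^ p) \<oplus>\<^bsub>M\<^esub> gact gki (cl (gen gy)) \<otimes>\<^bsub>M\<^esub> gact gf (cl (gen gy ^ p))"
      by (rule product_rules)
    also have "\<dots> = cl (scale (- q * inverse b0 + q powi 2 * (- inverse b0 * q powi (int p) * qint q (int p))) (gen gy ^ Suc (Suc p)))"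
      unfolding Suc.IH gact_generators ki1
      by (simp only: M_simps scale_mult scale_commute_mult scale_add_left scale_simps power2_eq_square power_Suc ac_simps)
    finally show ?case unfolding eq .
  qed
qed

text \<open>For \<open>f\<close> both factors of \<open>x\<^sup>m y\<^sup>p\<close> contribute, with coefficients \<open>[m]\<close> and
  \<open>- q\<^sup>p\<^sup>-\<^sup>m [p]\<close> up to a common factor; they add up to \<open>q\<^sup>p [m - p]\<close>, the coefficient whose vanishing
  at \<open>p = m\<close> creates the finite-dimensional submodule.\<close>

lemma gact_monomial: "gact g (cl (qp_monomial i)) = cl (lin qp_monomial (plane_gen q b0 g i))"
proof -
  obtain m p where i: "i = (m, p)" by force
  show ?thesis
  proof (cases g)
    case gk
    have "q powi (int m - 2 * int p) = q powi (- 2 * int p) * q powi (int m)"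
      using power_int_add[of q "- 2 * int p" "int m"] q_nonzero by simp
    then show ?thesis
      by (simp add: gk i qp_monomial_def plane_gen_def product_rules gact_x_power gact_y_power
          scale_mult scale_commute_mult)
  next
    case gki
    have "q powi (2 * int p - int m) = q powi (2 * int p) * q powi (- int m)"
      using power_int_add[of q "2 * int p" "- int m"] q_nonzero by simp
    then show ?thesis
      by (simp add: gki i qp_monomial_def plane_gen_def product_rules gact_x_power gact_y_power
          scale_mult scale_commute_mult)
  next
    case ge
    show ?thesis
    proof (cases p)
      case 0
      then show ?thesis by (simp add: ge i qp_monomial_def plane_gen_def gact_x_power)
    next
      case (Suc p')
      have "gact ge (cl (qp_monomial i)) = cl (gen gx ^ m) \<otimes>\<^bsub>M\<^esub> gact ge (cl (gen gy ^ Suc p'))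
          \<oplus>\<^bsub>M\<^esub> gact ge (cl (gen gx ^ m)) \<otimes>\<^bsub>M\<^esub> gact gk (cl (gen gy ^ Suc p'))"
        unfolding qp_monomial_def i Suc fst_conv snd_conv by (rule product_rules)
      also have "\<dots> = cl (scale (b0 * q powi (- int p') * qint q (int p' + 1)) (gen gx ^ m * gen gy ^ p'))"
        unfolding gact_x_power gact_y_power by (simp add: scale_commute_mult)
      finally show ?thesis by (simp add: ge i Suc qp_monomial_def plane_gen_def add.commute)
    qed
  next
    case gf
    have "gact gf (cl (qp_monomial i)) = gact gf (cl (gen gx ^ m)) \<otimes>\<^bsub>M\<^esub> cl (gen gy ^ p)
        \<oplus>\<^bsub>M\<^esub> gact gki (cl (gen gx ^ m)) \<otimes>\<^bsub>M\<^esub> gact gf (cl (gen gy ^ p))"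
      unfolding qp_monomial_def i fst_conv snd_conv by (rule product_rules)
    also have "\<dots> = cl (scale (inverse b0 * qint q (int m)
        + q powi (- int m) * (- inverse b0 * q powi (int p) * qint q (int p))) (gen gx ^ m * gen gy ^ Suc p))"
      unfolding gact_x_power gact_y_power
      by (simp only: M_simps scale_mult scale_commute_mult scale_add_left scale_simps power_Suc ac_simps)
    also have "inverse b0 * qint q (int m) + q powi (- int m) * (- inverse b0 * q powi (int p) * qint q (int p))
        = inverse b0 * q powi (int p) * qint q (int m - int p)"
    proof -
      have "qint q (int m) = q powi (int p) * qint q (int m - int p) + q powi (- int m) * q powi (int p) * qint q (int p)"
        using qint_add[OF q_nonzero, of "int p" "int m - int p"] power_int_add[of q "- int m" "int p"] q_nonzero
        by simp
      then show ?thesis by (simp add: algebra_simps)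
    qed
    finally show ?thesis by (simp add: gf i qp_monomial_def plane_gen_def)
  qed
qed

lemma gact_qp_elem: "gact g (qp_elem q c) = qp_elem q (lin (plane_gen q b0 g) c)"
proof (induction c rule: poly_mapping_induct)
  case zero
  show ?case using gact_scale[of g 0 0] gact_on_class[of g 0] by (auto simp: qp_elem_def)
next
  case (add i a c)
  have "gact g (qp_elem q (Poly_Mapping.single i a + c)) = a \<odot>\<^bsub>M\<^esub> gact g (cl (qp_monomial i)) \<oplus>\<^bsub>M\<^esub> gact g (qp_elem q c)"
    by (simp only: qp_elem_def lin_add lin_single gact_add gact_scale)
  also have "\<dots> = qp_elem q (lin (plane_gen q b0 g) (Poly_Mapping.single i a + c))"
    unfolding add.IH gact_monomial by (simp add: qp_elem_def lin_add lin_scale)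
  finally show ?case .
qed

end

section \<open>The subspaces \<open>x\<^sup>n \<complex>[y]\<close>\<close>

text \<open>The element \<open>x\<^sup>n w(y)\<close> for a polynomial \<open>w\<close>, given by its coefficients.\<close>

definition qp_slice :: "complex \<Rightarrow> nat \<Rightarrow> (nat \<Rightarrow>\<^sub>0 complex) \<Rightarrow> qp_gen free_alg set" where
  "qp_slice q n w = qp_elem q (lin (\<lambda>p. Poly_Mapping.single (n, p) 1) w)"

lemma qp_slice_residue: "qp_slice q n w = residue (qp_relators q) (lin (\<lambda>p. gen gx ^ n * gen gy ^ p) w)"
  by (simp add: qp_slice_def qp_elem_def lin_lin qp_monomial_def)

lemma lookup_row: "Poly_Mapping.lookup (lin (\<lambda>p. Poly_Mapping.single (n, p) 1) w) (m, p)
    = (if m = n then Poly_Mapping.lookup w p else 0)"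
  by (induction w rule: poly_mapping_induct) (auto simp: lin_add lookup_add lookup_single when_def)

lemma inj_qp_slice: "inj (qp_slice q n)"
proof (rule injI)
  fix v w assume "qp_slice q n v = qp_slice q n w"
  then have "lin (\<lambda>p. Poly_Mapping.single (n, p) 1) v = lin (\<lambda>p. Poly_Mapping.single (n, p) (1::complex)) w"
    unfolding qp_slice_def using inj_qp_elem by (rule injD[rotated])
  then have "Poly_Mapping.lookup (lin (\<lambda>p. Poly_Mapping.single (n, p) 1) v) (n, p)
      = Poly_Mapping.lookup (lin (\<lambda>p. Poly_Mapping.single (n, p) 1) w) (n, p)" for p
    by simp
  then show "v = w" by (intro poly_mapping_eqI) (simp add: lookup_row)
qed

lemma qp_slice_add: "qp_slice q n (v + w) = qp_slice q n v \<oplus>\<^bsub>qplane q\<^esub> qp_slice q n w"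
  and qp_slice_scale: "qp_slice q n (scale c w) = c \<odot>\<^bsub>qplane q\<^esub> qp_slice q n w"
  and qp_slice_zero: "qp_slice q n 0 = \<zero>\<^bsub>qplane q\<^esub>"
  and qp_slice_carrier: "qp_slice q n w \<in> carrier (qplane q)"
  by (simp_all add: qp_slice_def lin_add lin_scale qp_elem_add qp_elem_scale qp_elem_zero carrier_qplane)

lemma qplane_module: "Module.module class_ring (qplane q)"
  using presented_algebra_vectorspace unfolding qplane_def vectorspace_def by blast

lemma span_qp_slice:
  "LinearCombinations.module.span class_ring (qplane q) ((\<lambda>p. qp_slice q n (Poly_Mapping.single p 1)) ` T)
    = qp_slice q n ` {w. Poly_Mapping.keys w \<subseteq> T}"
  by (rule span_linear_image[OF qplane_module])
    (auto simp: qp_slice_add qp_slice_scale qp_slice_carrier)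

lemma monomial_qp_slice:
  "(qp_x q [^]\<^bsub>qplane q\<^esub> n) \<otimes>\<^bsub>qplane q\<^esub> (qp_y q [^]\<^bsub>qplane q\<^esub> p) = qp_slice q n (Poly_Mapping.single p 1)"
  by (simp add: qp_slice_residue qp_x_def qp_y_def qplane_def presented_algebra_pow presented_algebra_simps)

lemma qp_J_slice: "qp_J q n = qp_slice q n ` {w. Poly_Mapping.keys w \<subseteq> {..n}}"
  unfolding qp_J_def monomial_qp_slice by (rule span_qp_slice)

lemma qp_V_slice: "qp_V q n = range (qp_slice q n)"
proof -
  have "(\<lambda>p::nat. qp_y q [^]\<^bsub>qplane q\<^esub> p) = (\<lambda>p. qp_slice q 0 (Poly_Mapping.single p 1))"
    by (simp add: qp_slice_residue qp_y_def qplane_def presented_algebra_pow)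
  then have "poly_y q = qp_slice q 0 ` {w. Poly_Mapping.keys w \<subseteq> UNIV}"
    unfolding poly_y_def by (simp only: span_qp_slice)
  moreover have "(qp_x q [^]\<^bsub>qplane q\<^esub> n) \<otimes>\<^bsub>qplane q\<^esub> qp_slice q 0 w = qp_slice q n w" for w
    using lin_compose[of "\<lambda>r. gen gx ^ n * r" "\<lambda>p. gen gy ^ p" w]
    by (simp add: qp_slice_residue qp_x_def qplane_def presented_algebra_pow presented_algebra_simps
        distrib_left scale_commute_mult)
  ultimately show ?thesis unfolding qp_V_def by (auto simp: image_image)
qed

context qplane_action
begin

declare M_simps [simp del]

lemma M_eq_simps:
  "carrier M = carrier (qplane q)" "\<zero>\<^bsub>M\<^esub> = \<zero>\<^bsub>qplane q\<^esub>"
  "v \<oplus>\<^bsub>M\<^esub> w = v \<oplus>\<^bsub>qplane q\<^esub> w" "c \<odot>\<^bsub>M\<^esub> v = c \<odot>\<^bsub>qplane q\<^esub> v"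
  by (simp_all add: M_eq with_action_def)

abbreviation "sl n \<equiv> qp_slice q n"

lemma sl_simps:
  "sl n w \<in> carrier M" "sl n v \<oplus>\<^bsub>M\<^esub> sl n w = sl n (v + w)" "c \<odot>\<^bsub>M\<^esub> sl n w = sl n (scale c w)"
  "sl n v = sl n w \<longleftrightarrow> v = w" "sl n 0 = \<zero>\<^bsub>M\<^esub>"
  by (simp_all add: M_eq_simps qp_slice_add qp_slice_scale qp_slice_carrier qp_slice_zero inj_eq[OF inj_qp_slice])

lemma gact_sl: "gact g (sl n w) = sl n (lin (slice_gen q b0 n g) w)"
  by (simp add: qp_slice_def gact_qp_elem lin_lin plane_gen_def)

text \<open>The zero submodule, the finite-dimensional one and \<open>x\<^sup>n \<complex>[y]\<close> itself are all cut out by the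
  set \<open>T\<close> of exponents of \<open>y\<close> that may occur.\<close>

lemma sl_submodule:
  assumes stable: "\<And>g w. Poly_Mapping.keys w \<subseteq> T \<Longrightarrow> Poly_Mapping.keys (lin (slice_gen q b0 n g) w) \<subseteq> T"
  shows "uq_submodule q (sl n ` {w. Poly_Mapping.keys w \<subseteq> T}) M"
proof (rule M.submodule_closed_under_generators)
  let ?W = "sl n ` {w. Poly_Mapping.keys w \<subseteq> T}"
  show "submodule class_ring ?W M"
  proof
    show "?W \<subseteq> carrier M" using sl_simps(1) by blast
    show "v \<oplus>\<^bsub>M\<^esub> w \<in> ?W" if "v \<in> ?W" "w \<in> ?W" for v w
      using that keys_add by (fastforce simp: sl_simps)
    show "\<zero>\<^bsub>M\<^esub> \<in> ?W" unfolding sl_simps(5)[of n, symmetric] by (rule imageI) simp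
    show "c \<odot>\<^bsub>M\<^esub> v \<in> ?W" if "v \<in> ?W" for c v
    proof -
      obtain w where w: "v = sl n w" "Poly_Mapping.keys w \<subseteq> T" using \<open>v \<in> ?W\<close> by blast
      have "Poly_Mapping.keys (scale c w) \<subseteq> T" using w(2) by (auto simp: in_keys_iff)
      then show ?thesis unfolding w(1) sl_simps(3) by blast
    qed
  qed
  show "gact g v \<in> ?W" if "v \<in> ?W" for g v
    using that stable by (auto simp: gact_sl)
qed

lemma qp_V_submodule: "uq_submodule q (qp_V q n) M"
  using sl_submodule[of UNIV n] by (simp add: qp_V_slice)

lemma qp_J_submodule: "uq_submodule q (qp_J q n) M"
  unfolding qp_J_slice
proof (rule sl_submodule, rule keys_lin)
  fix g w i assume "Poly_Mapping.keys w \<subseteq> {..n}" "i \<in> Poly_Mapping.keys w"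
  then have "i \<le> n" by auto
  then show "Poly_Mapping.keys (slice_gen q b0 n g i) \<subseteq> {..n}"
    by (cases g) (auto simp: le_less)
qed

lemma qp_J_subset_V: "qp_J q n \<subset> qp_V q n"
proof
  show "qp_J q n \<subseteq> qp_V q n" by (auto simp: qp_J_slice qp_V_slice)
  have "sl n (Poly_Mapping.single (Suc n) 1) \<notin> qp_J q n"
    by (auto simp: qp_J_slice sl_simps)
  then show "qp_J q n \<noteq> qp_V q n" by (auto simp: qp_V_slice)
qed

text \<open>The component in \<open>x\<^sup>n \<complex>[y]\<close> is forced to be the part of the monomial expansion with
  \<open>x\<close>-exponent \<open>n\<close>.\<close>

lemma direct_sum: "uq_direct_sum q M (qp_V q)"
proof -
  define coord where "coord = inv_into UNIV (qp_elem q)"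
  have coord: "coord (qp_elem q c) = c" for c unfolding coord_def by (rule inv_f_f[OF inj_qp_elem])
  have car: "carrier M = range (qp_elem q)" by (simp add: M_eq_simps carrier_qplane)
  have coord_add: "coord (v \<oplus>\<^bsub>M\<^esub> w) = coord v + coord w" if "v \<in> carrier M" "w \<in> carrier M" for v w
    using that unfolding car by (auto simp: coord M_eq_simps(3) qp_elem_add[symmetric])
  have coord_zero: "coord \<zero>\<^bsub>M\<^esub> = 0" using coord[of 0] by (simp add: M_eq_simps qp_elem_zero)
  have coord_sl: "coord (sl n w) = lin (\<lambda>p. Poly_Mapping.single (n, p) 1) w" for n w
    by (simp add: qp_slice_def coord)
  let ?supp = "\<lambda>u. {i::nat. u i \<noteq> \<zero>\<^bsub>M\<^esub>}"
  \<comment> \<open>The coefficients of a sum of elements of the summands are the coefficients of its terms;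
    existence and uniqueness both follow.\<close>
  have sum_lookup: "Poly_Mapping.lookup (coord (\<Oplus>\<^bsub>M\<^esub>i\<in>?supp (\<lambda>i. sl i (w i)). sl i (w i))) (m, p)
      = Poly_Mapping.lookup (w m) p" if fin: "finite (?supp (\<lambda>i. sl i (w i)))" for w m p
  proof -
    have "coord (\<Oplus>\<^bsub>M\<^esub>i\<in>?supp (\<lambda>i. sl i (w i)). sl i (w i)) = (\<Sum>i\<in>?supp (\<lambda>i. sl i (w i)). coord (sl i (w i)))"
      by (rule hom_finsum[OF M.abelian_monoid_axioms]) (use sl_simps(1) coord_add coord_zero in auto)
    then have "Poly_Mapping.lookup (coord (\<Oplus>\<^bsub>M\<^esub>i\<in>?supp (\<lambda>i. sl i (w i)). sl i (w i))) (m, p)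
        = (\<Sum>i\<in>?supp (\<lambda>i. sl i (w i)). if m = i then Poly_Mapping.lookup (w i) p else 0)"
      by (simp add: lookup_sum coord_sl lookup_row)
    also have "\<dots> = (if m \<in> ?supp (\<lambda>i. sl i (w i)) then Poly_Mapping.lookup (w m) p else 0)"
      using fin by simp
    also have "\<dots> = Poly_Mapping.lookup (w m) p"
      using sl_simps(4)[of m "w m" 0] sl_simps(5)[of m] by auto
    finally show ?thesis .
  qed
  have "\<exists>!u. (\<forall>i. u i \<in> qp_V q i) \<and> finite (?supp u) \<and> v = (\<Oplus>\<^bsub>M\<^esub>i\<in>?supp u. u i)"
    if v: "v \<in> carrier M" for v
  proof -
    obtain c where c: "v = qp_elem q c" using v car by blast
    define r where "r n = lin (\<lambda>i. if fst i = n then Poly_Mapping.single (snd i) 1 else 0) c" for n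
    have r: "Poly_Mapping.lookup (r n) p = Poly_Mapping.lookup c (n, p)" for n p
    proof -
      have "Poly_Mapping.lookup (if fst i = n then Poly_Mapping.single (snd i) 1 else 0) p
          = (if i = (n, p) then 1 else (0::complex))" for i
        by (cases i) (auto simp: lookup_single when_def)
      then show ?thesis
        by (simp add: r_def lookup_lin in_keys_iff if_distrib[of "\<lambda>x. _ * x"] cong: if_cong)
    qed
    have "?supp (\<lambda>i. sl i (r i)) \<subseteq> fst ` Poly_Mapping.keys c"
    proof
      fix i assume "i \<in> ?supp (\<lambda>i. sl i (r i))"
      then have "sl i (r i) \<noteq> sl i 0" by (simp only: sl_simps(5) mem_Collect_eq not_False_eq_True)
      then have "r i \<noteq> 0" by auto
      then obtain p where "Poly_Mapping.lookup (r i) p \<noteq> 0" using poly_mapping_eqI[of "r i" 0] by auto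
      then have "(i, p) \<in> Poly_Mapping.keys c" by (simp add: r in_keys_iff)
      then show "i \<in> fst ` Poly_Mapping.keys c" by force
    qed
    then have fin: "finite (?supp (\<lambda>i. sl i (r i)))" by (rule finite_subset) simp
    have "(\<Oplus>\<^bsub>M\<^esub>i\<in>?supp (\<lambda>i. sl i (r i)). sl i (r i)) \<in> carrier M"
      by (rule M.finsum_closed) (use sl_simps(1) in auto)
    then obtain d where d: "(\<Oplus>\<^bsub>M\<^esub>i\<in>?supp (\<lambda>i. sl i (r i)). sl i (r i)) = qp_elem q d" using car by blast
    have "d = c"
      using sum_lookup[OF fin] unfolding d coord r by (intro poly_mapping_eqI) (metis surj_pair)
    then have eq: "v = (\<Oplus>\<^bsub>M\<^esub>i\<in>?supp (\<lambda>i. sl i (r i)). sl i (r i))" using c d by simp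
    show ?thesis
    proof (rule ex1I[of _ "\<lambda>i. sl i (r i)"])
      show "(\<forall>i. sl i (r i) \<in> qp_V q i) \<and> finite (?supp (\<lambda>i. sl i (r i)))
          \<and> v = (\<Oplus>\<^bsub>M\<^esub>i\<in>?supp (\<lambda>i. sl i (r i)). sl i (r i))"
        using fin eq by (simp add: qp_V_slice)
    next
      fix u assume u: "(\<forall>i. u i \<in> qp_V q i) \<and> finite (?supp u) \<and> v = (\<Oplus>\<^bsub>M\<^esub>i\<in>?supp u. u i)"
      then have "\<forall>i. \<exists>w. u i = sl i w" by (auto simp: qp_V_slice)
      then obtain w where w: "u = (\<lambda>i. sl i (w i))" by metis
      have "Poly_Mapping.lookup (w m) p = Poly_Mapping.lookup c (m, p)" for m p
        using sum_lookup[of w m p] u unfolding w by (metis c coord)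
      then have "w = r" by (intro ext poly_mapping_eqI) (simp add: r)
      then show "u = (\<lambda>i. sl i (r i))" by (simp add: w)
    qed
  qed
  then show ?thesis unfolding uq_direct_sum_def using qp_V_submodule by blast
qed

section \<open>The composition factors of \<open>x\<^sup>n \<complex>[y]\<close>\<close>

context
  fixes n :: nat
begin

definition slc :: "qp_gen free_alg set \<Rightarrow> (nat \<Rightarrow>\<^sub>0 complex)" where
  "slc = inv_into UNIV (sl n)"

lemma slc_sl [simp]: "slc (sl n w) = w"
  unfolding slc_def by (rule inv_f_f[OF inj_qp_slice])

abbreviation "VM \<equiv> M\<lparr>carrier := qp_V q n\<rparr>"
abbreviation "JM \<equiv> M\<lparr>carrier := qp_J q n\<rparr>"

lemma VM: "uq_module q VM" and JM: "uq_module q JM"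
  by (rule M.submodule_uq_module[OF qp_V_submodule] M.submodule_uq_module[OF qp_J_submodule])+

lemma slc_VM:
  "\<lbrakk>v \<in> qp_V q n; w \<in> qp_V q n\<rbrakk> \<Longrightarrow> slc (v \<oplus>\<^bsub>M\<^esub> w) = slc v + slc w"
  "v \<in> qp_V q n \<Longrightarrow> slc (c \<odot>\<^bsub>M\<^esub> v) = scale c (slc v)"
  "v \<in> qp_V q n \<Longrightarrow> slc (gact g v) = lin (slice_gen q b0 n g) (slc v)"
  by (auto simp: qp_V_slice sl_simps gact_sl)

text \<open>The scalar by which \<open>x\<^sup>n y\<^sup>i\<close> is identified with a multiple of \<open>v\<^sub>i\<close>. Comparing the
  raising operators on both sides prescribes the ratio of consecutive scalars; comparing the lowering
  operators leads to the same ratio (\<open>V1_coeff_Suc\<close>).\<close>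

definition V1_coeff :: "nat \<Rightarrow> complex" where
  "V1_coeff i = (\<Prod>j<i. b0 * q powi (- int j) * qint q (int j + 1) / qint q (int n - int j))"

definition to_V1 :: "qp_gen free_alg set \<Rightarrow> (nat \<Rightarrow>\<^sub>0 complex)" where
  "to_V1 v = lin (\<lambda>i. Poly_Mapping.single i (V1_coeff i)) (slc v)"

lemma V1_coeff_nonzero: "i \<le> n \<Longrightarrow> V1_coeff i \<noteq> 0"
  by (auto simp: V1_coeff_def b0_nonzero q_nonzero qint_nonzero)

lemma V1_coeff_Suc:
  assumes "i < n"
  shows "V1_coeff (Suc i) * qint q (int n - int i) = V1_coeff i * (b0 * q powi (- int i) * qint q (int i + 1))"
  using assms qint_nonzero[of "int n - int i"] by (simp add: V1_coeff_def)

lemma V1_intertwine: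
  assumes "i \<le> n"
  shows "lin (\<lambda>i. Poly_Mapping.single i (V1_coeff i)) (slice_gen q b0 n g i)
    = lin (V1_gen q n g) (Poly_Mapping.single i (V1_coeff i))"
proof (cases g)
  case ge
  show ?thesis
  proof (cases i)
    case 0
    then show ?thesis by (simp add: ge)
  next
    case (Suc j)
    then show ?thesis
      using V1_coeff_Suc[of j] assms V1_gen_qint(1)[of q n j] unfolding ge by (simp add: ac_simps)
  qed
next
  case gf
  have "q powi int i * q powi (- int i) = 1"
    using power_int_add[of q "int i" "- int i"] q_nonzero by simp
  then have "inverse b0 * q powi int i * (V1_coeff (Suc i) * qint q (int n - int i)) = V1_coeff i * qint q (int i + 1)"
    if "i < n" using V1_coeff_Suc[OF that] b0_nonzero by (simp add: field_simps)
  then show ?thesis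
    using assms V1_gen_qint(2)[of q n i] unfolding gf by (auto simp: ac_simps le_less simp del: V1_gen.simps)
qed (simp_all add: mult.commute)

lemma to_V1:
  "\<lbrakk>v \<in> qp_J q n; w \<in> qp_J q n\<rbrakk> \<Longrightarrow> to_V1 (v \<oplus>\<^bsub>M\<^esub> w) = to_V1 v + to_V1 w"
  "v \<in> qp_J q n \<Longrightarrow> to_V1 (c \<odot>\<^bsub>M\<^esub> v) = scale c (to_V1 v)"
  "v \<in> qp_J q n \<Longrightarrow> to_V1 (gact g v) = lin (V1_gen q n g) (to_V1 v)"
  "to_V1 ` qp_J q n = {w. Poly_Mapping.keys w \<subseteq> {..n}}"
  "inj_on to_V1 (qp_J q n)"
proof -
  have JV: "v \<in> qp_V q n" if "v \<in> qp_J q n" for v using that qp_J_subset_V by blast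
  show "to_V1 (v \<oplus>\<^bsub>M\<^esub> w) = to_V1 v + to_V1 w" if "v \<in> qp_J q n" "w \<in> qp_J q n"
    using that by (simp add: to_V1_def slc_VM JV lin_add)
  show "to_V1 (c \<odot>\<^bsub>M\<^esub> v) = scale c (to_V1 v)" if "v \<in> qp_J q n"
    using that by (simp add: to_V1_def slc_VM JV lin_scale)
  show "to_V1 (gact g v) = lin (V1_gen q n g) (to_V1 v)" if "v \<in> qp_J q n"
  proof -
    have "Poly_Mapping.keys (slc v) \<subseteq> {..n}" using that by (auto simp: qp_J_slice)
    then show ?thesis
      unfolding to_V1_def slc_VM(3)[OF JV[OF that]] lin_lin
      by (intro lin_cong V1_intertwine) auto
  qed
  have lookup: "Poly_Mapping.lookup (to_V1 (sl n w)) j = V1_coeff j * Poly_Mapping.lookup w j" for w j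
    by (simp add: to_V1_def lookup_diagonal)
  show "to_V1 ` qp_J q n = {w. Poly_Mapping.keys w \<subseteq> {..n}}"
  proof
    show "to_V1 ` qp_J q n \<subseteq> {w. Poly_Mapping.keys w \<subseteq> {..n}}"
      by (force simp: qp_J_slice in_keys_iff lookup)
    show "{w. Poly_Mapping.keys w \<subseteq> {..n}} \<subseteq> to_V1 ` qp_J q n"
    proof
      fix w :: "nat \<Rightarrow>\<^sub>0 complex" assume w: "w \<in> {w. Poly_Mapping.keys w \<subseteq> {..n}}"
      define w' where "w' = lin (\<lambda>i. Poly_Mapping.single i (inverse (V1_coeff i))) w"
      have w'_lookup: "Poly_Mapping.lookup w' j = inverse (V1_coeff j) * Poly_Mapping.lookup w j" for j
        by (simp add: w'_def lookup_diagonal)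
      have "to_V1 (sl n w') = w"
      proof (rule poly_mapping_eqI)
        fix j
        show "Poly_Mapping.lookup (to_V1 (sl n w')) j = Poly_Mapping.lookup w j"
          using V1_coeff_nonzero[of j] w by (cases "j \<le> n") (auto simp: lookup w'_lookup in_keys_iff subset_iff)
      qed
      moreover have "Poly_Mapping.keys w' \<subseteq> {..n}" using w by (force simp: in_keys_iff w'_lookup)
      ultimately show "w \<in> to_V1 ` qp_J q n" unfolding qp_J_slice by (metis (mono_tags) image_eqI mem_Collect_eq)
    qed
  qed
  show "inj_on to_V1 (qp_J q n)"
  proof (rule inj_onI)
    fix v v' assume "v \<in> qp_J q n" "v' \<in> qp_J q n" and eq: "to_V1 v = to_V1 v'"
    then obtain w w' where w: "v = sl n w" "v' = sl n w'" "Poly_Mapping.keys w \<subseteq> {..n}" "Poly_Mapping.keys w' \<subseteq> {..n}"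
      by (auto simp: qp_J_slice)
    have "Poly_Mapping.lookup w j = Poly_Mapping.lookup w' j" for j
    proof (cases "j \<le> n")
      case True
      have "V1_coeff j * Poly_Mapping.lookup w j = V1_coeff j * Poly_Mapping.lookup w' j"
        using arg_cong[OF eq, of "\<lambda>z. Poly_Mapping.lookup z j"] by (simp add: w lookup)
      then show ?thesis using V1_coeff_nonzero[OF True] by simp
    next
      case False
      then have "j \<notin> Poly_Mapping.keys w" "j \<notin> Poly_Mapping.keys w'" using w by auto
      then show ?thesis by (simp add: in_keys_iff)
    qed
    then show "v = v'" unfolding w by (intro arg_cong[of _ _ "sl n"] poly_mapping_eqI)
  qed
qed

lemma J_isomorphic_V1: "uq_isomorphic q JM (V1 q n)"
  and J_quotient_zero: "uq_isomorphic q (uq_quotient JM {\<zero>\<^bsub>M\<^esub>}) (V1 q n)"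
  and V1_simple: "uq_simple q (V1 q n)"
proof -
  interpret J: uq_module q JM by (rule JM)
  have prem: "\<And>v w. \<lbrakk>v \<in> carrier JM; w \<in> carrier JM\<rbrakk> \<Longrightarrow> to_V1 (v \<oplus>\<^bsub>JM\<^esub> w) = to_V1 v + to_V1 w"
    "\<And>c v. v \<in> carrier JM \<Longrightarrow> to_V1 (c \<odot>\<^bsub>JM\<^esub> v) = scale c (to_V1 v)"
    "\<And>g v. v \<in> carrier JM \<Longrightarrow> to_V1 (act JM (uq_class q (gen g)) v) = lin (V1_gen q n g) (to_V1 v)"
    "to_V1 ` carrier JM = {w. Poly_Mapping.keys w \<subseteq> {..n}}"
    using to_V1 by simp_all
  have inj: "inj_on to_V1 (carrier JM)" using to_V1(5) by simp
  note image = J.basis_module_image[OF prem]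
  show "uq_isomorphic q JM (V1 q n)"
    unfolding V1_def by (rule J.basis_module_quotient(2)[OF prem inj])
  have z: "\<zero>\<^bsub>M\<^esub> \<in> qp_J q n" using J.zero_closed by simp
  have tz: "to_V1 \<zero>\<^bsub>M\<^esub> = 0"
    by (simp only: sl_simps(5)[of n, symmetric] to_V1_def slc_sl lin_zero)
  have "{v \<in> carrier JM. to_V1 v = 0} = {\<zero>\<^bsub>M\<^esub>}"
  proof -
    have "v = \<zero>\<^bsub>M\<^esub>" if "v \<in> qp_J q n" "to_V1 v = 0" for v
      by (rule inj_onD[OF to_V1(5)]) (use that z tz in simp_all)
    then have "v \<in> qp_J q n \<and> to_V1 v = 0 \<longleftrightarrow> v = \<zero>\<^bsub>M\<^esub>" for v using z tz by blast
    then show ?thesis by (simp add: set_eq_iff)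
  qed
  then show "uq_isomorphic q (uq_quotient JM {\<zero>\<^bsub>M\<^esub>}) (V1 q n)"
    using J.basis_module_quotient(1)[OF prem] by (simp only: V1_def)
  show "uq_simple q (V1 q n)"
    unfolding V1_def
  proof (rule ladder_simple[OF image(1) image(3)])
    show "Suc i \<in> {..n} \<Longrightarrow> i \<in> {..n} \<and> qint q (int n - int i) \<noteq> 0 \<and>
      V1_gen q n ge (Suc i) = Poly_Mapping.single i (qint q (int n - int i))" for i
      using qint_nonzero[of "int n - int i"] unfolding V1_gen_qint by simp
    show "Suc i \<in> {..n} \<Longrightarrow> qint q (int i + 1) \<noteq> 0 \<and>
      V1_gen q n gf i = Poly_Mapping.single (Suc i) (qint q (int i + 1))" for i
      using qint_nonzero[of "int i + 1"] unfolding V1_gen_qint by simp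
  qed simp_all
qed

lemma J_dim: "vectorspace.fin_dim class_ring JM" "vectorspace.dim class_ring JM = n + 1"
proof -
  have "vectorspace class_ring JM" using JM by (simp add: uq_module_def)
  moreover have "bij_betw to_V1 (carrier JM) {w. Poly_Mapping.keys w \<subseteq> {..n}}"
    using to_V1(4,5) by (simp add: bij_betw_def)
  ultimately show "vectorspace.fin_dim class_ring JM" "vectorspace.dim class_ring JM = n + 1"
    using dim_of_coordinates[of JM to_V1 "{..n}"] to_V1(1,2) by simp_all
qed

text \<open>As before, the raising operators prescribe the ratio of consecutive scalars, now for the
  identification of \<open>x\<^sup>n y\<^sup>n\<^sup>+\<^sup>1\<^sup>+\<^sup>i\<close> with a multiple of \<open>v\<^sub>i\<close>; here \<open>f\<close> contributes \<open>[- 1 - i]\<close> on one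
  side and \<open>[i + 1]\<close> on the other, so the quantum integers cancel up to sign.\<close>

definition verma_coeff :: "nat \<Rightarrow> complex" where
  "verma_coeff i = (\<Prod>j<i. - b0 * q powi (- int (n + 1 + j)))"

abbreviation verma_shift :: "nat \<Rightarrow> (nat \<Rightarrow>\<^sub>0 complex)" where
  "verma_shift \<equiv> \<lambda>i. if i < Suc n then 0 else Poly_Mapping.single (i - Suc n) (verma_coeff (i - Suc n))"

definition to_verma :: "qp_gen free_alg set \<Rightarrow> (nat \<Rightarrow>\<^sub>0 complex)" where
  "to_verma v = lin verma_shift (slc v)"

lemma verma_coeff_nonzero: "verma_coeff i \<noteq> 0"
  by (auto simp: verma_coeff_def b0_nonzero q_nonzero)

text \<open>The cut is invisible to \<open>f\<close>, which annihilates the rung \<open>n\<close>, and \<open>e\<close> maps the rung \<open>n + 1\<close>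
  to one that is dropped, in accordance with \<open>e v\<^sub>0 = 0\<close>.\<close>

lemma verma_intertwine:
  "lin verma_shift (slice_gen q b0 n g i) = lin (verma_gen q (q powi (- int n - 2)) g) (verma_shift i)"
proof (cases "i < Suc n")
  case True
  then show ?thesis by (cases g) (auto simp: less_Suc_eq)
next
  case False
  then obtain j where i: "i = Suc n + j" by (metis le_Suc_ex not_less)
  note vg = verma_gen_qint[OF q_nonzero, of n]
  have coeff: "verma_coeff (Suc j) = - b0 * q powi (- int (n + 1 + j)) * verma_coeff j" for j
    by (simp add: verma_coeff_def)
  show ?thesis
  proof (cases g)
    case gk
    have e: "int n - 2 * int i = - int n - 2 - 2 * int j" by (simp add: i)
    show ?thesis unfolding gk slice_gen.simps e by (simp add: i vg mult.commute del: verma_gen.simps of_nat_add of_nat_Suc)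
  next
    case gki
    have e: "2 * int i - int n = int n + 2 + 2 * int j" by (simp add: i)
    show ?thesis unfolding gki slice_gen.simps e by (simp add: i vg mult.commute del: verma_gen.simps of_nat_add of_nat_Suc)
  next
    case ge
    show ?thesis
    proof (cases j)
      case 0
      then show ?thesis by (simp add: ge i)
    next
      case (Suc l)
      have "- int n - 2 - int l = - int i" by (simp add: i Suc)
      then have e: "qint q (int i) = - qint q (- int n - 2 - int l)"
        using qint_uminus[of q "int i"] by simp
      have e': "1 - int i = - int (n + 1 + l)" by (simp add: i Suc)
      show ?thesis
        unfolding ge slice_gen.simps e e'
        by (simp add: i Suc vg coeff ac_simps del: verma_gen.simps of_nat_add of_nat_Suc)
    qed
  next
    case gf
    have "int n - int i = - (int j + 1)" by (simp add: i)
    then have neg: "qint q (int n - int i) = - qint q (int j + 1)" by (simp only: qint_uminus)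
    have "int (n + 1 + j) = int i" by (simp add: i)
    then have inv: "q powi (int i) * q powi (- int (n + 1 + j)) = 1"
      using power_int_add[of q "int i" "- int i"] q_nonzero by simp
    have "inverse b0 * q powi (int i) * qint q (int n - int i) * verma_coeff (Suc j)
        = (inverse b0 * b0) * (q powi (int i) * q powi (- int (n + 1 + j))) * (verma_coeff j * qint q (int j + 1))"
      unfolding neg coeff by (simp only: mult_minus_left mult_minus_right minus_minus ac_simps)
    then have "inverse b0 * q powi (int i) * qint q (int n - int i) * verma_coeff (Suc j)
       = verma_coeff j * qint q (int j + 1)"
      unfolding inv using b0_nonzero by simp
    then show ?thesis
      unfolding gf slice_gen.simps by (simp add: i vg del: verma_gen.simps of_nat_add of_nat_Suc)
  qed
qed

lemma to_verma_lookup: "Poly_Mapping.lookup (to_verma (sl n w)) j = verma_coeff j * Poly_Mapping.lookup w (Suc n + j)"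
  unfolding to_verma_def slc_sl by (rule lookup_shift)

lemma to_verma_kernel: "{v \<in> qp_V q n. to_verma v = 0} = qp_J q n"
proof -
  have "to_verma (sl n w) = 0 \<longleftrightarrow> Poly_Mapping.keys w \<subseteq> {..n}" for w
  proof
    assume z: "to_verma (sl n w) = 0"
    show "Poly_Mapping.keys w \<subseteq> {..n}"
    proof
      fix i assume i: "i \<in> Poly_Mapping.keys w"
      show "i \<in> {..n}"
      proof (rule ccontr)
        assume "i \<notin> {..n}"
        then obtain j where "i = Suc n + j" by (metis atMost_iff le_Suc_ex not_less_eq_eq)
        then show False using i to_verma_lookup[of w j] verma_coeff_nonzero[of j] by (simp add: z in_keys_iff)
      qed
    qed
  next
    assume k: "Poly_Mapping.keys w \<subseteq> {..n}"
    show "to_verma (sl n w) = 0"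
    proof (rule poly_mapping_eqI)
      fix j
      have "Suc n + j \<notin> Poly_Mapping.keys w" using k by auto
      then show "Poly_Mapping.lookup (to_verma (sl n w)) j = Poly_Mapping.lookup 0 j"
        unfolding to_verma_lookup by (simp add: in_keys_iff)
    qed
  qed
  then show ?thesis by (auto simp: qp_V_slice qp_J_slice)
qed

lemma quotient_isomorphic_verma: "uq_isomorphic q (uq_quotient VM (qp_J q n)) (verma q (q powi (- int n - 2)))"
  and verma_simple: "uq_simple q (verma q (q powi (- int n - 2)))"
proof -
  interpret V: uq_module q VM by (rule VM)
  let ?b = "verma_gen q (q powi (- int n - 2))"
  have surj: "to_verma ` qp_V q n = {w. Poly_Mapping.keys w \<subseteq> UNIV}"
  proof -
    have "\<exists>w. to_verma (sl n w) = u" for u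
    proof
      let ?w = "lin (\<lambda>j. Poly_Mapping.single (Suc n + j) (inverse (verma_coeff j))) u"
      have "lin verma_shift (Poly_Mapping.single (Suc n + j) (inverse (verma_coeff j))) = Poly_Mapping.single j 1" for j
        using verma_coeff_nonzero[of j] by simp
      then show "to_verma (sl n ?w) = u" by (simp only: to_verma_def slc_sl lin_lin lin_single_id)
    qed
    then show ?thesis unfolding qp_V_slice by (auto simp: image_iff) metis
  qed
  have linear: "\<lbrakk>v \<in> qp_V q n; w \<in> qp_V q n\<rbrakk> \<Longrightarrow> to_verma (v \<oplus>\<^bsub>M\<^esub> w) = to_verma v + to_verma w"
    "v \<in> qp_V q n \<Longrightarrow> to_verma (c \<odot>\<^bsub>M\<^esub> v) = scale c (to_verma v)"
    "v \<in> qp_V q n \<Longrightarrow> to_verma (gact g v) = lin (?b g) (to_verma v)" for v w c g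
    by (simp_all only: to_verma_def slc_VM lin_add lin_scale lin_lin verma_intertwine)
  have prem: "\<And>v w. \<lbrakk>v \<in> carrier VM; w \<in> carrier VM\<rbrakk> \<Longrightarrow> to_verma (v \<oplus>\<^bsub>VM\<^esub> w) = to_verma v + to_verma w"
    "\<And>c v. v \<in> carrier VM \<Longrightarrow> to_verma (c \<odot>\<^bsub>VM\<^esub> v) = scale c (to_verma v)"
    "\<And>g v. v \<in> carrier VM \<Longrightarrow> to_verma (act VM (uq_class q (gen g)) v) = lin (?b g) (to_verma v)"
    "to_verma ` carrier VM = {w. Poly_Mapping.keys w \<subseteq> UNIV}"
    using surj linear by simp_all
  note image = V.basis_module_image[OF prem]
  show "uq_isomorphic q (uq_quotient VM (qp_J q n)) (verma q (q powi (- int n - 2)))"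
    using V.basis_module_quotient(1)[OF prem] to_verma_kernel by (simp add: verma_def)
  show "uq_simple q (verma q (q powi (- int n - 2)))"
    unfolding verma_def
  proof (rule ladder_simple[OF image(1) image(3)])
    show "Suc i \<in> UNIV \<Longrightarrow> i \<in> UNIV \<and> qint q (- int n - 2 - int i) \<noteq> 0 \<and>
      ?b ge (Suc i) = Poly_Mapping.single i (qint q (- int n - 2 - int i))" for i
      using qint_nonzero[of "- int n - 2 - int i"] unfolding verma_gen_qint[OF q_nonzero] by simp
    show "Suc i \<in> UNIV \<Longrightarrow> qint q (int i + 1) \<noteq> 0 \<and>
      ?b gf i = Poly_Mapping.single (Suc i) (qint q (int i + 1))" for i
      using qint_nonzero[of "int i + 1"] unfolding verma_gen_qint[OF q_nonzero] by simp
  qed simp_all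
qed

text \<open>A complement would be a nonzero submodule, hence would contain \<open>x\<^sup>n\<close>, which lies in
  the submodule to be complemented.\<close>

lemma J_not_direct_summand: "\<not> uq_direct_summand q (qp_J q n) VM"
proof
  assume "uq_direct_summand q (qp_J q n) VM"
  then obtain W where W: "uq_submodule q W VM" and sum: "qp_J q n <+>\<^bsub>VM\<^esub> W = qp_V q n"
    and int: "qp_J q n \<inter> W = {\<zero>\<^bsub>M\<^esub>}"
    by (auto simp: uq_direct_summand_def)
  interpret W: submodule class_ring W VM using W by (simp add: uq_submodule_def)
  have WV: "W \<subseteq> qp_V q n" using W.subset by simp
  have "W \<noteq> {\<zero>\<^bsub>M\<^esub>}"
  proof
    assume "W = {\<zero>\<^bsub>M\<^esub>}"
    have "v \<in> qp_J q n" if "v \<in> qp_V q n" for v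
    proof -
      have "v \<in> qp_J q n <+>\<^bsub>VM\<^esub> W" using that sum by simp
      then obtain a b where ab: "a \<in> qp_J q n" "b \<in> W" "v = a \<oplus>\<^bsub>M\<^esub> b"
        by (auto simp: set_add_def set_mult_def)
      then have "b = \<zero>\<^bsub>M\<^esub>" using \<open>W = {\<zero>\<^bsub>M\<^esub>}\<close> by blast
      moreover have "a \<in> carrier M" using ab(1) sl_simps(1) by (auto simp: qp_J_slice)
      ultimately show ?thesis using ab M.r_zero[of a] by simp
    qed
    then show False using qp_J_subset_V by blast
  qed
  then obtain w where w: "sl n w \<in> W" "w \<noteq> 0"
    using W.zero_closed WV sl_simps(5)[of n] unfolding qp_V_slice by auto
  let ?U = "{u. sl n u \<in> W}"
  have "Poly_Mapping.single 0 1 \<in> ?U"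
  proof (rule lowering_reaches_bottom[where S = UNIV and b = "slice_gen q b0 n ge"])
    show "u \<in> ?U \<Longrightarrow> scale c u \<in> ?U" for c u
      using W.smult_closed[of c "sl n u"] sl_simps(3) by simp
    show "u \<in> ?U \<Longrightarrow> lin (slice_gen q b0 n ge) u \<in> ?U" for u
      using W uq_class_in_Uq[of q "gen ge"] by (auto simp: uq_submodule_def gact_sl[symmetric])
    show "i \<in> UNIV \<and> b0 * q powi (- int i) * qint q (int i + 1) \<noteq> 0 \<and>
      slice_gen q b0 n ge (Suc i) = Poly_Mapping.single i (b0 * q powi (- int i) * qint q (int i + 1))" for i
      using qint_nonzero[of "int i + 1"] by (simp add: b0_nonzero q_nonzero add.commute)
  qed (use w in simp_all)
  moreover have "sl n (Poly_Mapping.single 0 1) \<in> qp_J q n" by (auto simp: qp_J_slice)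
  ultimately have "sl n (Poly_Mapping.single 0 1) = \<zero>\<^bsub>M\<^esub>" using int by blast
  then have "Poly_Mapping.single 0 (1::complex) = (0 :: nat \<Rightarrow>\<^sub>0 complex)"
    using sl_simps(4,5) by metis
  then show False by (metis lookup_single_eq lookup_zero zero_neq_one)
qed

text \<open>The first factor is the finite-dimensional submodule modulo zero, the second one the
  Verma module.\<close>

lemma J_composition_series: "composition_series q VM [{\<zero>\<^bsub>M\<^esub>}, qp_J q n, qp_V q n]"
proof -
  have zero_sub: "uq_submodule q {\<zero>\<^bsub>M\<^esub>} M"
    using sl_submodule[of "{}" n] by (simp add: sl_simps(5) lin_def)
  have zero_J: "{\<zero>\<^bsub>M\<^esub>} \<subset> qp_J q n"
  proof -
    have "\<zero>\<^bsub>M\<^esub> \<in> qp_J q n" unfolding sl_simps(5)[of n, symmetric] qp_J_slice by (rule imageI) simp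
    moreover have "qp_J q n \<noteq> {\<zero>\<^bsub>M\<^esub>}"
      using uq_simple_isomorphic[OF J_isomorphic_V1 V1_simple] by (auto simp: uq_simple_def)
    ultimately show ?thesis by blast
  qed
  have sub: "uq_submodule q N VM" if "N \<in> {{\<zero>\<^bsub>M\<^esub>}, qp_J q n, qp_V q n}" for N
    using that zero_J qp_J_subset_V
    by (intro M.uq_submodule_of_submodule qp_V_submodule) (auto simp: zero_sub qp_J_submodule qp_V_submodule)
  have s1: "uq_simple q (uq_quotient JM {\<zero>\<^bsub>M\<^esub>})"
    by (rule uq_simple_isomorphic[OF J_quotient_zero V1_simple])
  have s2: "uq_simple q (uq_quotient VM (qp_J q n))"
    by (rule uq_simple_isomorphic[OF quotient_isomorphic_verma verma_simple])
  show ?thesis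
    unfolding composition_series_def
    using sub zero_J qp_J_subset_V s1 s2
    by (auto simp: less_Suc_eq nth_Cons split: nat.splits)
qed

end

end

theorem proposition20:
  fixes q b0 :: complex
    and \<pi> :: "uq_gen free_alg set \<Rightarrow> qp_gen free_alg set \<Rightarrow> qp_gen free_alg set"
    and M :: "qp_gen free_alg set uq_module"
  assumes q_nonzero: "q \<noteq> 0"
    and q_not_root_of_unity: "\<forall>m::nat. m > 0 \<longrightarrow> q ^ m \<noteq> 1"
    and b0_nonzero: "b0 \<noteq> 0"
    and M_eq: "M = with_action (qplane q) \<pi>"
    and module_algebra: "uq_module_algebra q M"
    and k_x: "\<pi> (uq_class q (gen gk)) (qp_x q) = q \<odot>\<^bsub>qplane q\<^esub> qp_x q"
    and k_y: "\<pi> (uq_class q (gen gk)) (qp_y q) = q powi (-2) \<odot>\<^bsub>qplane q\<^esub> qp_y q"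
    and e_x: "\<pi> (uq_class q (gen ge)) (qp_x q) = \<zero>\<^bsub>qplane q\<^esub>"
    and e_y: "\<pi> (uq_class q (gen ge)) (qp_y q) = b0 \<odot>\<^bsub>qplane q\<^esub> \<one>\<^bsub>qplane q\<^esub>"
    and f_x: "\<pi> (uq_class q (gen gf)) (qp_x q) =
                inverse b0 \<odot>\<^bsub>qplane q\<^esub> (qp_x q \<otimes>\<^bsub>qplane q\<^esub> qp_y q)"
    and f_y: "\<pi> (uq_class q (gen gf)) (qp_y q) =
                (- q * inverse b0) \<odot>\<^bsub>qplane q\<^esub> (qp_y q [^]\<^bsub>qplane q\<^esub> (2::nat))"
  shows "uq_direct_sum q M (qp_V q) \<and>
    (\<forall>n::nat.
       composition_series q (M\<lparr>carrier := qp_V q n\<rparr>) [{\<zero>\<^bsub>M\<^esub>}, qp_J q n, qp_V q n] \<and>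
       uq_simple q (M\<lparr>carrier := qp_J q n\<rparr>) \<and>
       vectorspace.fin_dim class_ring (M\<lparr>carrier := qp_J q n\<rparr>) \<and>
       vectorspace.dim class_ring (M\<lparr>carrier := qp_J q n\<rparr>) = n + 1 \<and>
       uq_isomorphic q (M\<lparr>carrier := qp_J q n\<rparr>) (V1 q n) \<and>
       \<not> uq_direct_summand q (qp_J q n) (M\<lparr>carrier := qp_V q n\<rparr>) \<and>
       uq_isomorphic q (uq_quotient (M\<lparr>carrier := qp_V q n\<rparr>) (qp_J q n))
         (verma q (q powi (- int n - 2))) \<and>
       uq_simple q (verma q (q powi (- int n - 2))))"
proof -
  interpret qplane_action q b0 \<pi> M
    by (intro qplane_action.intro generic_q.intro qplane_action_axioms.intro) (fact assms)+
  show ?thesis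
    using direct_sum J_composition_series uq_simple_isomorphic[OF J_isomorphic_V1 V1_simple] J_dim
      J_isomorphic_V1 J_not_direct_summand quotient_isomorphic_verma verma_simple
    by blast
qed

end
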